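(* Let $R$ be a complete Noetherian (commutative) local ring, let $\mathcal M$ be a class of Matlis-dualizable $R$-modules closed under taking submodules and quotient modules, and let $\alpha$ be a submodule selector on $\mathcal M$, with smile dual $\alpha^{\smile}$ (a submodule selector on $\mathcal M^\vee$). Then: (1) $(\alpha^{\smile})^{\smile}=\alpha$. (2) $\alpha$ is surjection-functorial if and only if $\alpha^{\smile}$ is order-preserving. (3) $\alpha$ is idempotent if and only if $\alpha^{\smile}$ is co-idempotent.
   Context: Let $\mathfrak m$ be the maximal ideal of $R$, $k=R/\mathfrak m$, $E=E_R(k)$ the injective hull of $k$, and $(-)^\vee=\operatorname{Hom}_R(-,E)$. A module $M$ is Matlis-dualizable if the natural map $M\to M^{\vee\vee}$ is an isomorphism; $M$ and $M^{\vee\vee}$ are identified via this map. (For example $\mathcal M$ may be the finitely generated modules, or the Artinian modules.) $\mathcal M$ is taken closed under isomorphism, and $\mathcal M^\vee$ is the class of modules isomorphic to $M^\vee$ for some $M\in\mathcal M$. A submodule selector on $\mathcal M$ is a function $\alpha:\mathcal M\to\mathcal M$ such that $\alpha(M)$ is a submodule of $M$ for every $M\in\mathcal M$, and $\varphi(\alpha(M))=\alpha(N)$ for every isomorphism $\varphi:M\to N$ in $\mathcal M$. It is: order-preserving if $\alpha(L)\subseteq\alpha(M)$ whenever $L\subseteq M$ are in $\mathcal M$; surjection-functorial if $\pi(\alpha(M))\subseteq\alpha(N)$ for every surjection $\pi:M\to N$ in $\mathcal M$; idempotent if $\alpha(\alpha(M))=\alpha(M)$ for all $M\in\mathcal M$;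 co-idempotent if $\alpha(M/\alpha(M))=0$ for all $M\in\mathcal M$. The smile dual of a submodule selector $\alpha$ on $\mathcal M$ is the submodule selector $\alpha^{\smile}$ on $\mathcal M^\vee$ given by $\alpha^{\smile}(M):=(M^\vee/\alpha(M^\vee))^\vee$ for $M\in\mathcal M^\vee$, regarded as a submodule of $M$ via the inclusion $(M^\vee/\alpha(M^\vee))^\vee\hookrightarrow M^{\vee\vee}\cong M$ dual to the quotient map. *)

theory Defs
  imports "HOL-Algebra.Ring_Divisibility" "HOL-Algebra.Ideal_Product" "HOL-Algebra.Module"
begin

section \<open>Complete Noetherian local rings\<close>

definition ideal_power :: "('r, 's) ring_scheme \<Rightarrow> 'r set \<Rightarrow> nat \<Rightarrow> 'r set" where
  "ideal_power R I n = (ideal_prod R I ^^ n) (carrier R)"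

text \<open>The inverse limit of the rings \<open>R/I\<^sup>n\<close>, as a set of coherent sequences of cosets:
  the transition map from \<open>R/I\<^sup>n\<^sup>+\<^sup>1\<close> to \<open>R/I\<^sup>n\<close> sends a coset to the unique coset containing it.\<close>

definition adic_completion :: "('r, 's) ring_scheme \<Rightarrow> 'r set \<Rightarrow> (nat \<Rightarrow> 'r set) set" where
  "adic_completion R I =
     {s. \<forall>n. s n \<in> carrier (R Quot ideal_power R I n) \<and> s (Suc n) \<subseteq> s n}"

definition adically_complete :: "('r, 's) ring_scheme \<Rightarrow> 'r set \<Rightarrow> bool" where
  "adically_complete R I \<longleftrightarrow>
     bij_betw (\<lambda>r n. ideal_power R I n +>\<^bsub>R\<^esub> r) (carrier R) (adic_completion R I)"

locale complete_noetherian_local_ring = cring R + noetherian_ring R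
  for R (structure) +
  fixes \<mm>
  assumes maximal: "maximalideal \<mm> R"
    and unique_maximal: "\<And>J. maximalideal J R \<Longrightarrow> J = \<mm>"
    and complete: "adically_complete R \<mm>"


section \<open>Modules\<close>

text \<open>The record type of modules extends that of rings; its fields \<open>mult\<close> and \<open>one\<close> carry no
  information about a module. They are ignored by every notion below, and set to
  \<open>undefined\<close> in the constructions.\<close>

definition module_hom ::
  "('r, 's) ring_scheme \<Rightarrow> ('r, 'a) module \<Rightarrow> ('r, 'b) module \<Rightarrow> ('a \<Rightarrow> 'b) set" where
  "module_hom R M N = {f \<in> carrier M \<rightarrow> carrier N.
     (\<forall>x\<in>carrier M. \<forall>y\<in>carrier M. f (x \<oplus>\<^bsub>M\<^esub> y) = f x \<oplus>\<^bsub>N\<^esub> f y) \<and>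
     (\<forall>r\<in>carrier R. \<forall>x\<in>carrier M. f (r \<odot>\<^bsub>M\<^esub> x) = r \<odot>\<^bsub>N\<^esub> f x)}"

definition module_iso ::
  "('r, 's) ring_scheme \<Rightarrow> ('r, 'a) module \<Rightarrow> ('r, 'b) module \<Rightarrow> ('a \<Rightarrow> 'b) set" where
  "module_iso R M N = {f \<in> module_hom R M N. bij_betw f (carrier M) (carrier N)}"

definition regular_module :: "('r, 's) ring_scheme \<Rightarrow> ('r, 'r) module" where
  "regular_module R = \<lparr>carrier = carrier R, mult = undefined, one = undefined,
     zero = \<zero>\<^bsub>R\<^esub>, add = add R, smult = mult R\<rparr>"

abbreviation restrict_module :: "('r, 'a) module \<Rightarrow> 'a set \<Rightarrow> ('r, 'a) module" where
  "restrict_module M N \<equiv> M\<lparr>carrier := N\<rparr>"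

definition quotient_module :: "('r, 'a) module \<Rightarrow> 'a set \<Rightarrow> ('r, 'a set) module" where
  "quotient_module M N = \<lparr>carrier = a_rcosets\<^bsub>M\<^esub> N, mult = undefined, one = undefined,
     zero = N, add = set_add M, smult = (\<lambda>r X. \<Union>x\<in>X. N +>\<^bsub>M\<^esub> (r \<odot>\<^bsub>M\<^esub> x))\<rparr>"

text \<open>A predicate cannot quantify over all carrier types. The test modules \<open>A\<close> and \<open>B\<close> below
  range over all modules carried by the type of the ring. These include the inclusions of the
  ideals into the ring, so by Baer's criterion the notion agrees with injectivity tested on
  modules over arbitrary types.\<close>

definition injective_module :: "('r, 's) ring_scheme \<Rightarrow> ('r, 'e) module \<Rightarrow> bool" where
  "injective_module R E \<longleftrightarrow> module R E \<and>
     (\<forall>(A :: ('r, 'r) module) (B :: ('r, 'r) module). \<forall>f\<in>module_hom R A B. \<forall>g\<in>module_hom R A E.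
        module R A \<and> module R B \<and> inj_on f (carrier A) \<longrightarrow>
        (\<exists>h\<in>module_hom R B E. \<forall>x\<in>carrier A. h (f x) = g x))"

definition injective_hull :: "('r, 's) ring_scheme \<Rightarrow> ('r, 'k) module \<Rightarrow> ('r, 'e) module \<Rightarrow> bool" where
  "injective_hull R K E \<longleftrightarrow> module R K \<and> injective_module R E \<and>
     (\<exists>\<iota>\<in>module_hom R K E. inj_on \<iota> (carrier K) \<and>
        (\<forall>N. submodule N R E \<and> N \<noteq> {\<zero>\<^bsub>E\<^esub>} \<longrightarrow> N \<inter> \<iota> ` carrier K \<noteq> {\<zero>\<^bsub>E\<^esub>}))"


section \<open>Matlis duality\<close>

text \<open>The module of homomorphisms from \<open>M\<close> to \<open>E\<close>. A homomorphism is represented by the function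
  that is \<open>undefined\<close> outside the carrier of \<open>M\<close>.\<close>

definition matlis_dual ::
  "('r, 's) ring_scheme \<Rightarrow> ('r, 'e) module \<Rightarrow> ('r, 'a) module \<Rightarrow> ('r, 'a \<Rightarrow> 'e) module" where
  "matlis_dual R E M = \<lparr>carrier = module_hom R M E \<inter> extensional (carrier M),
     mult = undefined, one = undefined,
     zero = (\<lambda>x\<in>carrier M. \<zero>\<^bsub>E\<^esub>),
     add = (\<lambda>f g. \<lambda>x\<in>carrier M. f x \<oplus>\<^bsub>E\<^esub> g x),
     smult = (\<lambda>r f. \<lambda>x\<in>carrier M. r \<odot>\<^bsub>E\<^esub> f x)\<rparr>"

text \<open>The dual of a homomorphism out of \<open>M\<close>, given by precomposition.\<close>

definition dual_map :: "('r, 'a) module \<Rightarrow> ('a \<Rightarrow> 'b) \<Rightarrow> ('b \<Rightarrow> 'e) \<Rightarrow> ('a \<Rightarrow> 'e)" where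
  "dual_map M \<phi> f = (\<lambda>x\<in>carrier M. f (\<phi> x))"

definition bidual_map ::
  "('r, 's) ring_scheme \<Rightarrow> ('r, 'e) module \<Rightarrow> ('r, 'a) module \<Rightarrow> 'a \<Rightarrow> ('a \<Rightarrow> 'e) \<Rightarrow> 'e" where
  "bidual_map R E M x = (\<lambda>f\<in>carrier (matlis_dual R E M). f x)"

definition matlis_dualizable ::
  "('r, 's) ring_scheme \<Rightarrow> ('r, 'e) module \<Rightarrow> ('r, 'a) module \<Rightarrow> bool" where
  "matlis_dualizable R E M \<longleftrightarrow> module R M \<and>
     bidual_map R E M \<in> module_iso R M (matlis_dual R E (matlis_dual R E M))"


section \<open>Classes of modules\<close>

text \<open>A class of modules is given by its members carried by one type \<open>'m\<close>. Duals and quotients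
  are carried by other types; such a module belongs to the class if it is isomorphic to a member
  carried by \<open>'m\<close>. As \<open>'m\<close> is arbitrary, and quotients of modules carried by \<open>'m\<close> have isomorphic
  copies carried by \<open>'m\<close> (choose representatives of the cosets), this is no restriction for
  classes whose members are bounded in cardinality.\<close>

definition module_class :: "('r, 's) ring_scheme \<Rightarrow> ('r, 'm) module set \<Rightarrow> bool" where
  "module_class R \<M> \<longleftrightarrow> (\<forall>M\<in>\<M>. module R M) \<and>
     (\<forall>M\<in>\<M>. \<forall>N. module R N \<and> module_iso R M N \<noteq> {} \<longrightarrow> N \<in> \<M>)"

definition in_class ::
  "('r, 's) ring_scheme \<Rightarrow> ('r, 'm) module set \<Rightarrow> ('r, 'a) module \<Rightarrow> bool" where
  "in_class R \<M> X \<longleftrightarrow> module R X \<and> (\<exists>N\<in>\<M>. module_iso R X N \<noteq> {})"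

definition closed_under_submodules ::
  "('r, 's) ring_scheme \<Rightarrow> ('r, 'm) module set \<Rightarrow> bool" where
  "closed_under_submodules R \<M> \<longleftrightarrow>
     (\<forall>M\<in>\<M>. \<forall>N. submodule N R M \<longrightarrow> restrict_module M N \<in> \<M>)"

definition closed_under_quotients ::
  "('r, 's) ring_scheme \<Rightarrow> ('r, 'm) module set \<Rightarrow> bool" where
  "closed_under_quotients R \<M> \<longleftrightarrow>
     (\<forall>M\<in>\<M>. \<forall>N. submodule N R M \<longrightarrow> in_class R \<M> (quotient_module M N))"

text \<open>The members of the dual class carried by a type \<open>'d\<close>. All isomorphism types occur as soon
  as \<open>'d\<close> is large enough to carry a copy of the dual of each member of \<open>\<M>\<close>, for
  example if \<open>'d\<close> is \<open>'m \<Rightarrow> 'e\<close>.\<close>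

definition dual_class ::
  "('r, 's) ring_scheme \<Rightarrow> ('r, 'e) module \<Rightarrow> ('r, 'm) module set \<Rightarrow> ('r, 'd) module set" where
  "dual_class R E \<M> =
     {X. module R X \<and> (\<exists>M\<in>\<M>. module_iso R X (matlis_dual R E M) \<noteq> {})}"


section \<open>Submodule selectors\<close>

text \<open>The module \<open>\<alpha>(M)\<close> is represented by its underlying subset of \<open>M\<close>.\<close>

type_synonym ('r, 'm) selector = "('r, 'm) module \<Rightarrow> 'm set"

definition submodule_selector ::
  "('r, 's) ring_scheme \<Rightarrow> ('r, 'm) module set \<Rightarrow> ('r, 'm) selector \<Rightarrow> bool" where
  "submodule_selector R \<M> \<alpha> \<longleftrightarrow>
     (\<forall>M\<in>\<M>. submodule (\<alpha> M) R M \<and> restrict_module M (\<alpha> M) \<in> \<M>) \<and>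
     (\<forall>M\<in>\<M>. \<forall>N\<in>\<M>. \<forall>\<phi>\<in>module_iso R M N. \<phi> ` \<alpha> M = \<alpha> N)"

text \<open>The value of a selector at a module \<open>X\<close> of the class that is carried by an arbitrary type:
  the submodule corresponding to \<open>\<alpha>(N)\<close> under any isomorphism of \<open>X\<close> with a member \<open>N\<close> of \<open>\<M>\<close>.
  By invariance under isomorphisms, it does not depend on the choice of \<open>N\<close> and of the
  isomorphism, and equals \<open>\<alpha>(X)\<close> if \<open>X \<in> \<M>\<close>.\<close>

definition selector_at ::
  "('r, 's) ring_scheme \<Rightarrow> ('r, 'm) module set \<Rightarrow> ('r, 'm) selector \<Rightarrow> ('r, 'a) module \<Rightarrow> 'a set" where
  "selector_at R \<M> \<alpha> X = {x \<in> carrier X. \<exists>N\<in>\<M>. \<exists>\<phi>\<in>module_iso R X N. \<phi> x \<in> \<alpha> N}"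

definition order_preserving ::
  "('r, 's) ring_scheme \<Rightarrow> ('r, 'm) module set \<Rightarrow> ('r, 'm) selector \<Rightarrow> bool" where
  "order_preserving R \<M> \<alpha> \<longleftrightarrow>
     (\<forall>M\<in>\<M>. \<forall>L. submodule L R M \<and> restrict_module M L \<in> \<M> \<longrightarrow> \<alpha> (restrict_module M L) \<subseteq> \<alpha> M)"

definition surjection_functorial ::
  "('r, 's) ring_scheme \<Rightarrow> ('r, 'm) module set \<Rightarrow> ('r, 'm) selector \<Rightarrow> bool" where
  "surjection_functorial R \<M> \<alpha> \<longleftrightarrow>
     (\<forall>M\<in>\<M>. \<forall>N\<in>\<M>. \<forall>\<pi>\<in>module_hom R M N. \<pi> ` carrier M = carrier N \<longrightarrow> \<pi> ` \<alpha> M \<subseteq> \<alpha> N)"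

definition idempotent_selector :: "('r, 'm) module set \<Rightarrow> ('r, 'm) selector \<Rightarrow> bool" where
  "idempotent_selector \<M> \<alpha> \<longleftrightarrow> (\<forall>M\<in>\<M>. \<alpha> (restrict_module M (\<alpha> M)) = \<alpha> M)"

definition co_idempotent_selector ::
  "('r, 's) ring_scheme \<Rightarrow> ('r, 'm) module set \<Rightarrow> ('r, 'm) selector \<Rightarrow> bool" where
  "co_idempotent_selector R \<M> \<alpha> \<longleftrightarrow>
     (\<forall>M\<in>\<M>. selector_at R \<M> \<alpha> (quotient_module M (\<alpha> M)) = {\<zero>\<^bsub>quotient_module M (\<alpha> M)\<^esub>})"

text \<open>The dual of the quotient map from \<open>D = M\<^sup>\<or>\<close> to \<open>D/A\<close>, where \<open>A = \<alpha>(D)\<close>, maps the dual of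
  \<open>D/A\<close> into the bidual of \<open>M\<close>; its image is pulled back to \<open>M\<close> along the natural map.\<close>

definition smile_dual ::
  "('r, 's) ring_scheme \<Rightarrow> ('r, 'e) module \<Rightarrow> ('r, 'm) module set \<Rightarrow> ('r, 'm) selector
     \<Rightarrow> ('r, 'd) selector" where
  "smile_dual R E \<M> \<alpha> M =
     (let D = matlis_dual R E M;
          A = selector_at R \<M> \<alpha> D
      in {x \<in> carrier M. bidual_map R E M x \<in>
            dual_map D (\<lambda>f. A +>\<^bsub>D\<^esub> f) ` carrier (matlis_dual R E (quotient_module D A))})"

end

theory Submission
  imports Defs
begin

text \<open>The smile dual at \<open>X \<cong> M\<^sup>\<or>\<close> is the annihilator in \<open>X\<close> of \<open>\<alpha>(M)\<close>, under the pairing of \<open>X\<close> with \<open>M\<close>.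
  Since every quotient of \<open>M\<close> is dualizable, the homomorphisms to \<open>E\<close> vanishing on a submodule \<open>K\<close>
  separate the points outside \<open>K\<close> from \<open>K\<close>. So taking the annihilator twice gives back \<open>\<alpha>(M)\<close>,
  and a surjection \<open>M \<rightarrow> N\<close> maps \<open>\<alpha>(M)\<close> into \<open>\<alpha>(N)\<close> iff its dual \<open>N\<^sup>\<or> \<rightarrow> M\<^sup>\<or>\<close> maps the annihilator
  of \<open>\<alpha>(N)\<close> into that of \<open>\<alpha>(M)\<close>. Injectivity of \<open>E\<close> makes the dual of an inclusion a surjection;
  hence inclusions in the dual class come from surjections in \<open>\<M>\<close>, and the quotient of \<open>M\<^sup>\<or>\<close> by
  the annihilator of \<open>\<alpha>(M)\<close> is \<open>\<alpha>(M)\<^sup>\<or>\<close>, which turns idempotence into co-idempotence.\<close>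


section \<open>Homomorphisms, submodules and quotients\<close>

lemma module_homI:
  assumes "\<And>x. x \<in> carrier M \<Longrightarrow> f x \<in> carrier N"
    and "\<And>x y. x \<in> carrier M \<Longrightarrow> y \<in> carrier M \<Longrightarrow> f (x \<oplus>\<^bsub>M\<^esub> y) = f x \<oplus>\<^bsub>N\<^esub> f y"
    and "\<And>r x. r \<in> carrier R \<Longrightarrow> x \<in> carrier M \<Longrightarrow> f (r \<odot>\<^bsub>M\<^esub> x) = r \<odot>\<^bsub>N\<^esub> f x"
  shows "f \<in> module_hom R M N"
  using assms by (auto simp: module_hom_def)

lemma module_homD:
  assumes "f \<in> module_hom R M N"
  shows "x \<in> carrier M \<Longrightarrow> f x \<in> carrier N"
    and "x \<in> carrier M \<Longrightarrow> y \<in> carrier M \<Longrightarrow> f (x \<oplus>\<^bsub>M\<^esub> y) = f x \<oplus>\<^bsub>N\<^esub> f y"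
    and "r \<in> carrier R \<Longrightarrow> x \<in> carrier M \<Longrightarrow> f (r \<odot>\<^bsub>M\<^esub> x) = r \<odot>\<^bsub>N\<^esub> f x"
  using assms by (auto simp: module_hom_def)

lemma module_hom_zero:
  assumes "f \<in> module_hom R M N" "module R M" "module R N"
  shows "f \<zero>\<^bsub>M\<^esub> = \<zero>\<^bsub>N\<^esub>"
proof -
  interpret M: module R M by fact
  interpret N: module R N by fact
  \<comment> \<open>The definition of \<open>module_hom\<close> says nothing about zero; its
    preservation comes from scaling by the zero of \<open>R\<close>.\<close>
  have "f (\<zero>\<^bsub>R\<^esub> \<odot>\<^bsub>M\<^esub> \<zero>\<^bsub>M\<^esub>) = \<zero>\<^bsub>R\<^esub> \<odot>\<^bsub>N\<^esub> f \<zero>\<^bsub>M\<^esub>"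
    by (rule module_homD(3)[OF assms(1)]) auto
  then show ?thesis
    using module_homD(1)[OF assms(1)] by simp
qed

lemma module_hom_uminus:
  assumes "f \<in> module_hom R M N" "module R M" "module R N" "x \<in> carrier M"
  shows "f (\<ominus>\<^bsub>M\<^esub> x) = \<ominus>\<^bsub>N\<^esub> f x"
proof -
  interpret M: module R M by fact
  interpret N: module R N by fact
  have "f (\<ominus>\<^bsub>M\<^esub> x) \<oplus>\<^bsub>N\<^esub> f x = \<zero>\<^bsub>N\<^esub>"
    using module_homD(2)[OF assms(1), of "\<ominus>\<^bsub>M\<^esub> x" x] assms(4) module_hom_zero[OF assms(1-3)]
    by (simp add: M.l_neg)
  then show ?thesis
    using module_homD(1)[OF assms(1)] assms(4) by (intro N.minus_equality[symmetric]) auto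
qed

lemma module_hom_minus:
  assumes "f \<in> module_hom R M N" "module R M" "module R N" "x \<in> carrier M" "y \<in> carrier M"
  shows "f (x \<ominus>\<^bsub>M\<^esub> y) = f x \<ominus>\<^bsub>N\<^esub> f y"
proof -
  interpret M: module R M by fact
  show ?thesis
    using assms by (simp add: a_minus_def module_homD(2)[OF assms(1)] module_hom_uminus)
qed

lemma (in abelian_group) minus_eq_zero_iff:
  assumes "x \<in> carrier G" "y \<in> carrier G"
  shows "x \<ominus> y = \<zero> \<longleftrightarrow> x = y"
proof
  assume "x \<ominus> y = \<zero>"
  then have "\<ominus> (\<ominus> y) = x"
    using assms by (intro minus_equality) (auto simp: a_minus_def)
  then show "x = y"
    using assms by simp
qed (use assms in \<open>simp add: a_minus_def r_neg\<close>)

lemma module_hom_inj_onI: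
  assumes "f \<in> module_hom R M N" "module R M" "module R N"
    and "\<And>x. x \<in> carrier M \<Longrightarrow> f x = \<zero>\<^bsub>N\<^esub> \<Longrightarrow> x = \<zero>\<^bsub>M\<^esub>"
  shows "inj_on f (carrier M)"
proof (rule inj_onI)
  interpret M: module R M by fact
  interpret N: module R N by fact
  fix x y assume xy: "x \<in> carrier M" "y \<in> carrier M" "f x = f y"
  then have "f (x \<ominus>\<^bsub>M\<^esub> y) = \<zero>\<^bsub>N\<^esub>"
    using module_homD(1)[OF assms(1)] by (simp add: module_hom_minus[OF assms(1-3)] N.minus_eq_zero_iff)
  then show "x = y"
    using assms(4)[of "x \<ominus>\<^bsub>M\<^esub> y"] xy by (simp add: M.minus_eq_zero_iff)
qed

lemma module_hom_comp:
  assumes "f \<in> module_hom R M N" "g \<in> module_hom R N P"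
  shows "(\<lambda>x. g (f x)) \<in> module_hom R M P"
  using assms by (intro module_homI) (simp_all add: module_homD)

lemma module_iso_hom: "f \<in> module_iso R M N \<Longrightarrow> f \<in> module_hom R M N"
  and module_iso_inj: "f \<in> module_iso R M N \<Longrightarrow> inj_on f (carrier M)"
  and module_iso_image: "f \<in> module_iso R M N \<Longrightarrow> f ` carrier M = carrier N"
  by (auto simp: module_iso_def bij_betw_def)

lemma module_isoI:
  assumes "f \<in> module_hom R M N" "inj_on f (carrier M)" "carrier N \<subseteq> f ` carrier M"
  shows "f \<in> module_iso R M N"
  using assms module_homD(1)[OF assms(1)] by (auto simp: module_iso_def bij_betw_def)

lemma module_iso_id: "(\<lambda>x. x) \<in> module_iso R M M"
  by (intro module_isoI module_homI) auto

lemma module_iso_comp: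
  assumes "f \<in> module_iso R M N" "g \<in> module_iso R N P"
  shows "(\<lambda>x. g (f x)) \<in> module_iso R M P"
  using assms bij_betw_trans[of f _ _ g]
  by (auto simp: module_iso_def module_hom_comp comp_def)

lemma module_iso_inv:
  assumes "f \<in> module_iso R M N" "module R M"
  shows "inv_into (carrier M) f \<in> module_iso R N M"
proof -
  interpret M: module R M by fact
  note hom = module_homD[OF module_iso_hom[OF assms(1)]]
  have bij: "bij_betw f (carrier M) (carrier N)"
    using assms by (simp add: module_iso_def)
  let ?g = "inv_into (carrier M) f"
  have g: "?g y \<in> carrier M" "f (?g y) = y" if "y \<in> carrier N" for y
    using that bij by (auto simp: bij_betw_def inv_into_into f_inv_into_f)
  have gf: "?g (f x) = x" if "x \<in> carrier M" for x
    using that bij by (simp add: bij_betw_def)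
  have "?g \<in> module_hom R N M"
  proof (rule module_homI)
    fix x y assume "x \<in> carrier N" "y \<in> carrier N"
    then show "?g (x \<oplus>\<^bsub>N\<^esub> y) = ?g x \<oplus>\<^bsub>M\<^esub> ?g y"
      using g gf[of "?g x \<oplus>\<^bsub>M\<^esub> ?g y"] by (simp add: hom)
  next
    fix r y assume "r \<in> carrier R" "y \<in> carrier N"
    then show "?g (r \<odot>\<^bsub>N\<^esub> y) = r \<odot>\<^bsub>M\<^esub> ?g y"
      using g gf[of "r \<odot>\<^bsub>M\<^esub> ?g y"] by (simp add: hom)
  qed (use g in auto)
  then show ?thesis
    using bij_betw_inv_into[OF bij] by (simp add: module_iso_def)
qed

section \<open>Submodules, their images and preimages\<close>

lemma submodule_subset: "submodule H R M \<Longrightarrow> H \<subseteq> carrier M"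
  using subgroup.subset[OF submodule.axioms(1), of H R M] by simp

lemma submodule_zero: "submodule H R M \<Longrightarrow> \<zero>\<^bsub>M\<^esub> \<in> H"
  using subgroup.one_closed[OF submodule.axioms(1), of H R M] by simp

lemma submodule_add: "submodule H R M \<Longrightarrow> x \<in> H \<Longrightarrow> y \<in> H \<Longrightarrow> x \<oplus>\<^bsub>M\<^esub> y \<in> H"
  using subgroup.m_closed[OF submodule.axioms(1), of H R M] by simp

lemma submodule_vimage:
  assumes "f \<in> module_hom R M N" "module R M" "module R N" "submodule K R N"
  shows "submodule {x \<in> carrier M. f x \<in> K} R M"
proof -
  interpret M: module R M by fact
  interpret N: module R N by fact
  show ?thesis
    using assms N.submoduleE[OF assms(4)] submodule_zero[OF assms(4)]
    by (intro M.submoduleI)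
      (auto simp: module_homD[OF assms(1)] module_hom_zero[OF assms(1-3)] module_hom_uminus[OF assms(1-3)])
qed

lemma (in module) zero_submodule: "submodule {\<zero>\<^bsub>M\<^esub>} R M"
  by (intro submoduleI) auto

lemma submodule_kernel:
  assumes "f \<in> module_hom R M N" "module R M" "module R N"
  shows "submodule {x \<in> carrier M. f x = \<zero>\<^bsub>N\<^esub>} R M"
  using submodule_vimage[OF assms module.zero_submodule[OF assms(3)]] by simp

lemma submodule_image:
  assumes "f \<in> module_hom R M N" "module R M" "module R N" "submodule K R M"
  shows "submodule (f ` K) R N"
proof -
  interpret M: module R M by fact
  interpret N: module R N by fact
  note hom = module_homD[OF assms(1)]
  have sub: "\<And>x. x \<in> K \<Longrightarrow> x \<in> carrier M"
    using submodule_subset[OF assms(4)] by auto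
  show ?thesis
  proof (rule N.submoduleI)
    show "f ` K \<subseteq> carrier N"
      using sub hom by auto
    show "\<zero>\<^bsub>N\<^esub> \<in> f ` K"
      using submodule_zero[OF assms(4)] module_hom_zero[OF assms(1-3)] by force
    fix a assume "a \<in> f ` K"
    then obtain x where x: "x \<in> K" "a = f x" by auto
    then show "\<ominus>\<^bsub>N\<^esub> a \<in> f ` K"
      using module_hom_uminus[OF assms(1-3) sub[OF x(1)]] M.submoduleE(3)[OF assms(4)] by force
    {
      fix b assume "b \<in> f ` K"
      then obtain y where y: "y \<in> K" "b = f y" by auto
      show "a \<oplus>\<^bsub>N\<^esub> b \<in> f ` K"
        using x y hom(2)[OF sub sub] submodule_add[OF assms(4) x(1) y(1)] by force
    }
    fix r assume r: "r \<in> carrier R"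
    show "r \<odot>\<^bsub>N\<^esub> a \<in> f ` K"
      using x hom(3)[OF r sub] M.submoduleE(4)[OF assms(4) r x(1)] by force
  qed
qed

lemma submodule_hom: "submodule H R M \<Longrightarrow> (\<lambda>x. x) \<in> module_hom R (restrict_module M H) M"
  using submodule_subset[of H R M] by (intro module_homI) auto

section \<open>Factoring through surjections, and quotient modules\<close>

text \<open>The map \<open>f\<close> is constant on the fibres of \<open>p\<close>, so it may be
  evaluated at any chosen preimage. Extensionality makes \<open>g\<close> an element of the dual of
  \<open>N\<close> when \<open>P\<close> is \<open>E\<close>.\<close>

lemma module_hom_factor:
  assumes "p \<in> module_hom R M N" "f \<in> module_hom R M P" "module R M" "module R N" "module R P"
    and "p ` carrier M = carrier N"
    and ker: "\<And>x. x \<in> carrier M \<Longrightarrow> p x = \<zero>\<^bsub>N\<^esub> \<Longrightarrow> f x = \<zero>\<^bsub>P\<^esub>"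
  obtains g where "g \<in> module_hom R N P" "g \<in> extensional (carrier N)"
    "\<And>x. x \<in> carrier M \<Longrightarrow> g (p x) = f x"
proof
  interpret M: module R M by fact
  interpret N: module R N by fact
  interpret P: module R P by fact
  note p = module_homD[OF assms(1)] and f = module_homD[OF assms(2)]
  define q where "q = inv_into (carrier M) p"
  have q: "q y \<in> carrier M" "p (q y) = y" if "y \<in> carrier N" for y
    using that assms(6) by (auto simp: q_def inv_into_into f_inv_into_f)
  have eq: "f x = f y" if "x \<in> carrier M" "y \<in> carrier M" "p x = p y" for x y
  proof -
    have "p (x \<ominus>\<^bsub>M\<^esub> y) = \<zero>\<^bsub>N\<^esub>"
      using that p by (simp add: module_hom_minus[OF assms(1,3,4)] N.minus_eq_zero_iff)
    then show ?thesis
      using that f ker[of "x \<ominus>\<^bsub>M\<^esub> y"] by (simp add: module_hom_minus[OF assms(2,3,5)] P.minus_eq_zero_iff)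
  qed
  let ?g = "\<lambda>y\<in>carrier N. f (q y)"
  show gp: "?g (p x) = f x" if "x \<in> carrier M" for x
    using that p q by (auto intro!: eq)
  show "?g \<in> module_hom R N P"
  proof (rule module_homI)
    fix x y assume "x \<in> carrier N" "y \<in> carrier N"
    then show "?g (x \<oplus>\<^bsub>N\<^esub> y) = ?g x \<oplus>\<^bsub>P\<^esub> ?g y"
      using gp[of "q x \<oplus>\<^bsub>M\<^esub> q y"] by (simp add: q p f)
  next
    fix r x assume "r \<in> carrier R" "x \<in> carrier N"
    then show "?g (r \<odot>\<^bsub>N\<^esub> x) = r \<odot>\<^bsub>P\<^esub> ?g x"
      using gp[of "r \<odot>\<^bsub>M\<^esub> q x"] by (simp add: q p f)
  qed (simp add: q f)
qed (rule restrict_extensional)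

text \<open>Each module axiom for \<open>Q\<close> is the image under \<open>p\<close> of the same
  axiom in \<open>M\<close>. Since \<open>Q\<close> is at first only a record, the condition on zero
  has to be assumed: deducing it from additivity and scaling would presuppose that \<open>Q\<close>
  is a module.\<close>

lemma module_image:
  assumes "module R M" "p ` carrier M = carrier Q" "p \<zero>\<^bsub>M\<^esub> = \<zero>\<^bsub>Q\<^esub>" "p \<in> module_hom R M Q"
  shows "module R Q"
proof -
  interpret M: module R M by fact
  note p = module_homD[OF assms(4)]
  show ?thesis
  proof (intro moduleI abelian_groupI M.is_cring)
    show "\<zero>\<^bsub>Q\<^esub> \<in> carrier Q"
      using p(1)[of "\<zero>\<^bsub>M\<^esub>"] assms(3) by simp
    fix x assume "x \<in> carrier Q"
    then obtain x' where x': "x' \<in> carrier M" "x = p x'"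
      using assms(2) by auto
    show "\<zero>\<^bsub>Q\<^esub> \<oplus>\<^bsub>Q\<^esub> x = x"
      using p(2)[of "\<zero>\<^bsub>M\<^esub>" x'] x' assms(3) by simp
    show "\<exists>y\<in>carrier Q. y \<oplus>\<^bsub>Q\<^esub> x = \<zero>\<^bsub>Q\<^esub>"
      using p(2)[of "\<ominus>\<^bsub>M\<^esub> x'" x'] x' assms(3) p(1)[of "\<ominus>\<^bsub>M\<^esub> x'"]
      by (intro bexI[of _ "p (\<ominus>\<^bsub>M\<^esub> x')"]) (simp_all add: M.l_neg)
    show "\<one>\<^bsub>R\<^esub> \<odot>\<^bsub>Q\<^esub> x = x"
      using p(3)[of "\<one>\<^bsub>R\<^esub>" x'] x' by simp
    {
      fix r assume r: "r \<in> carrier R"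
      show "r \<odot>\<^bsub>Q\<^esub> x \<in> carrier Q"
        using p(1)[of "r \<odot>\<^bsub>M\<^esub> x'"] p(3) r x' by simp
      fix s assume s: "s \<in> carrier R"
      show "(r \<oplus>\<^bsub>R\<^esub> s) \<odot>\<^bsub>Q\<^esub> x = r \<odot>\<^bsub>Q\<^esub> x \<oplus>\<^bsub>Q\<^esub> s \<odot>\<^bsub>Q\<^esub> x"
        using r s x' by (simp add: M.smult_l_distr flip: p(2,3))
      show "(r \<otimes>\<^bsub>R\<^esub> s) \<odot>\<^bsub>Q\<^esub> x = r \<odot>\<^bsub>Q\<^esub> (s \<odot>\<^bsub>Q\<^esub> x)"
        using r s x' by (simp add: M.smult_assoc1 flip: p(2,3))
    }
    fix y assume "y \<in> carrier Q"
    then obtain y' where y': "y' \<in> carrier M" "y = p y'"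
      using assms(2) by auto
    show "x \<oplus>\<^bsub>Q\<^esub> y \<in> carrier Q"
      using p(1)[of "x' \<oplus>\<^bsub>M\<^esub> y'"] x' y' by (simp add: p)
    show "x \<oplus>\<^bsub>Q\<^esub> y = y \<oplus>\<^bsub>Q\<^esub> x"
      using x' y' by (simp add: M.a_comm flip: p(2,3))
    show "r \<odot>\<^bsub>Q\<^esub> (x \<oplus>\<^bsub>Q\<^esub> y) = r \<odot>\<^bsub>Q\<^esub> x \<oplus>\<^bsub>Q\<^esub> r \<odot>\<^bsub>Q\<^esub> y" if "r \<in> carrier R" for r
      using that x' y' by (simp add: M.smult_r_distr flip: p(2,3))
    fix z assume "z \<in> carrier Q"
    then obtain z' where z': "z' \<in> carrier M" "z = p z'"
      using assms(2) by auto
    show "x \<oplus>\<^bsub>Q\<^esub> y \<oplus>\<^bsub>Q\<^esub> z = x \<oplus>\<^bsub>Q\<^esub> (y \<oplus>\<^bsub>Q\<^esub> z)"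
      using x' y' z' by (simp add: M.a_assoc flip: p(2,3))
  qed
qed

context
  fixes R :: "('r, 's) ring_scheme" and M :: "('r, 'a) module" and A
  assumes M: "module R M" and A: "submodule A R M"
begin

interpretation M: module R M by (rule M)

interpretation A: abelian_subgroup A M
  using A by (intro abelian_subgroupI3 additive_subgroupI M.abelian_group_axioms submodule.axioms(1))

lemma quotient_module_coset_eq: "x \<in> carrier M \<Longrightarrow> A +>\<^bsub>M\<^esub> x = A \<longleftrightarrow> x \<in> A"
  using M.a_coset_join1 A.a_rcos_const A.a_subgroup by blast

lemma quotient_module_proj: "(\<lambda>x. A +>\<^bsub>M\<^esub> x) \<in> module_hom R M (quotient_module M A)"
proof (rule module_homI)
  fix x assume x: "x \<in> carrier M"
  then show "A +>\<^bsub>M\<^esub> x \<in> carrier (quotient_module M A)"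
    using M.a_rcosetsI A.a_subset by (simp add: quotient_module_def)
  show "A +>\<^bsub>M\<^esub> (x \<oplus>\<^bsub>M\<^esub> y) = (A +>\<^bsub>M\<^esub> x) \<oplus>\<^bsub>quotient_module M A\<^esub> (A +>\<^bsub>M\<^esub> y)"
    if "y \<in> carrier M" for y
    using x that by (simp add: quotient_module_def A.a_rcos_sum)
  fix r assume r: "r \<in> carrier R"
  \<comment> \<open>Scalar multiplication of cosets is a union over all representatives. They all
    give the same coset, because \<open>A\<close> is stable under scalars, so the union collapses to
    it.\<close>
  have "A +>\<^bsub>M\<^esub> (r \<odot>\<^bsub>M\<^esub> y) = A +>\<^bsub>M\<^esub> (r \<odot>\<^bsub>M\<^esub> x)" if y: "y \<in> A +>\<^bsub>M\<^esub> x" for y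
  proof -
    obtain a where a: "a \<in> A" "y = a \<oplus>\<^bsub>M\<^esub> x"
      using y by (auto simp: a_r_coset_def')
    then have "r \<odot>\<^bsub>M\<^esub> y = r \<odot>\<^bsub>M\<^esub> a \<oplus>\<^bsub>M\<^esub> r \<odot>\<^bsub>M\<^esub> x" "r \<odot>\<^bsub>M\<^esub> a \<in> A"
      using r x A.a_Hcarr submodule.smult_closed[OF A] by (auto simp: M.smult_r_distr)
    then have "r \<odot>\<^bsub>M\<^esub> y \<in> A +>\<^bsub>M\<^esub> (r \<odot>\<^bsub>M\<^esub> x)"
      by (auto simp: a_r_coset_def')
    then show ?thesis
      using A.a_repr_independence' r x by simp
  qed
  then have "(\<Union>y\<in>A +>\<^bsub>M\<^esub> x. A +>\<^bsub>M\<^esub> (r \<odot>\<^bsub>M\<^esub> y)) = A +>\<^bsub>M\<^esub> (r \<odot>\<^bsub>M\<^esub> x)"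
    using A.a_rcos_self[OF x] by blast
  then show "A +>\<^bsub>M\<^esub> (r \<odot>\<^bsub>M\<^esub> x) = r \<odot>\<^bsub>quotient_module M A\<^esub> (A +>\<^bsub>M\<^esub> x)"
    by (simp add: quotient_module_def)
qed

lemma quotient_module_surj: "(\<lambda>x. A +>\<^bsub>M\<^esub> x) ` carrier M = carrier (quotient_module M A)"
  by (auto simp: quotient_module_def A_RCOSETS_def' a_r_coset_def')

lemma quotient_module_zero: "\<zero>\<^bsub>quotient_module M A\<^esub> = A"
  by (simp add: quotient_module_def)

lemma quotient_module_is_module: "module R (quotient_module M A)"
  using quotient_module_coset_eq[OF M.zero_closed] A.zero_closed
  by (intro module_image[OF M quotient_module_surj _ quotient_module_proj])
    (simp add: quotient_module_def)

end


section \<open>Baer's criterion\<close>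

lemma regular_module_simps [simp]:
  "carrier (regular_module R) = carrier R" "\<zero>\<^bsub>regular_module R\<^esub> = \<zero>\<^bsub>R\<^esub>"
  "add (regular_module R) = add R" "smult (regular_module R) = mult R"
  by (simp_all add: regular_module_def)

lemma (in cring) regular_module_is_module: "module R (regular_module R)"
  by (intro moduleI abelian_groupI is_cring)
    (auto simp: a_assoc m_assoc l_distr r_distr intro: a_comm l_neg)

lemma injective_moduleD:
  fixes E :: "('r, 'e) module" and A B :: "('r, 'r) module"
  assumes "injective_module R E" "module R A" "module R B"
    and "f \<in> module_hom R A B" "inj_on f (carrier A)" "g \<in> module_hom R A E"
  shows "\<exists>h\<in>module_hom R B E. \<forall>x\<in>carrier A. h (f x) = g x"
  using assms by (simp add: injective_module_def)

text \<open>A maximal extension of \<open>f\<close> is everywhere defined: for \<open>x\<close> in \<open>M\<close>, injectivity extends the map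
  \<open>r \<mapsto> g(rx)\<close> from the ideal of those \<open>r\<close> with \<open>rx\<close> in the domain to the whole ring. Partial extensions
  are represented by their graphs.\<close>

lemma injective_module_extend:
  fixes E :: "('r, 'e) module" and M :: "('r, 'a) module"
  assumes inj: "injective_module R E" and M: "module R M" and N: "submodule N R M"
    and f: "f \<in> module_hom R (restrict_module M N) E"
  obtains g where "g \<in> module_hom R M E" "\<And>x. x \<in> N \<Longrightarrow> g x = f x"
proof -
  interpret M: module R M by fact
  have E: "module R E"
    using inj by (simp add: injective_module_def)
  interpret E: module R E by fact
  \<comment> \<open>A partial graph is the graph of a homomorphism on a submodule containing
    \<open>N\<close> that agrees with \<open>f\<close> there. Single-valuedness is demanded only at
    zero; closure under addition and scalars spreads it to every point.\<close>
  define partial where "partial G \<longleftrightarrow> G \<subseteq> carrier M \<times> carrier E \<and> (\<lambda>x. (x, f x)) ` N \<subseteq> G \<and>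
      (\<forall>x a y b. (x, a) \<in> G \<longrightarrow> (y, b) \<in> G \<longrightarrow> (x \<oplus>\<^bsub>M\<^esub> y, a \<oplus>\<^bsub>E\<^esub> b) \<in> G) \<and>
      (\<forall>r x a. r \<in> carrier R \<longrightarrow> (x, a) \<in> G \<longrightarrow> (r \<odot>\<^bsub>M\<^esub> x, r \<odot>\<^bsub>E\<^esub> a) \<in> G) \<and>
      (\<forall>a. (\<zero>\<^bsub>M\<^esub>, a) \<in> G \<longrightarrow> a = \<zero>\<^bsub>E\<^esub>)" for G
  have f0: "f \<zero>\<^bsub>M\<^esub> = \<zero>\<^bsub>E\<^esub>"
    using module_hom_zero[OF f submodule.submodule_is_module[OF N M] E] by simp
  have "\<exists>G\<in>Collect partial. \<forall>X\<in>Collect partial. G \<subseteq> X \<longrightarrow> X = G"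
  proof (rule subset_Zorn_nonempty)
    have "partial ((\<lambda>x. (x, f x)) ` N)"
      using module_homD[OF f] submodule_subset[OF N] f0 submodule_add[OF N] M.submoduleE(4)[OF N]
      by (auto simp: partial_def)
    then show "Collect partial \<noteq> {}"
      by auto
    fix \<C> assume ne: "\<C> \<noteq> {}" and ch: "subset.chain (Collect partial) \<C>"
    have C: "partial G" if "G \<in> \<C>" for G
      using ch that by (auto simp: subset.chain_def)
    \<comment> \<open>Two pairs of the union lie in a common member of the chain, which is closed
      under addition.\<close>
    have add: "(x \<oplus>\<^bsub>M\<^esub> y, a \<oplus>\<^bsub>E\<^esub> b) \<in> \<Union>\<C>" if xy: "(x, a) \<in> \<Union>\<C>" "(y, b) \<in> \<Union>\<C>" for x a y b
    proof -
      obtain G H where GH: "G \<in> \<C>" "H \<in> \<C>" "(x, a) \<in> G" "(y, b) \<in> H"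
        using xy by auto
      then have "G \<subseteq> H \<or> H \<subseteq> G"
        using ch unfolding subset.chain_def by blast
      then obtain K where "K \<in> \<C>" "(x, a) \<in> K" "(y, b) \<in> K"
        using GH by blast
      then show ?thesis
        using C[of K] by (intro UnionI[of K]) (simp_all add: partial_def)
    qed
    have smult: "(r \<odot>\<^bsub>M\<^esub> x, r \<odot>\<^bsub>E\<^esub> a) \<in> \<Union>\<C>" if xa: "r \<in> carrier R" "(x, a) \<in> \<Union>\<C>" for r x a
    proof -
      obtain G where "G \<in> \<C>" "(x, a) \<in> G"
        using xa by auto
      then show ?thesis
        using C[of G] xa(1) by (intro UnionI[of G]) (simp_all add: partial_def)
    qed
    obtain G where G: "G \<in> \<C>"
      using ne by auto
    have "\<Union>\<C> \<subseteq> carrier M \<times> carrier E"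
      using C by (intro Union_least) (simp add: partial_def)
    moreover have "(\<lambda>x. (x, f x)) ` N \<subseteq> \<Union>\<C>"
      using C[OF G] G unfolding partial_def by (meson Union_upper subset_trans)
    moreover have "a = \<zero>\<^bsub>E\<^esub>" if "(\<zero>\<^bsub>M\<^esub>, a) \<in> \<Union>\<C>" for a
      using C that by (auto simp: partial_def)
    ultimately have "partial (\<Union>\<C>)"
      using add smult unfolding partial_def by (intro conjI allI impI)
    then show "\<Union>\<C> \<in> Collect partial"
      by simp
  qed
  then obtain G where "partial G" and max: "\<And>X. partial X \<Longrightarrow> G \<subseteq> X \<Longrightarrow> X = G"
    by auto
  then have sub: "\<And>x a. (x, a) \<in> G \<Longrightarrow> x \<in> carrier M \<and> a \<in> carrier E"
    and graph: "\<And>x. x \<in> N \<Longrightarrow> (x, f x) \<in> G"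
    and add: "\<And>x a y b. (x, a) \<in> G \<Longrightarrow> (y, b) \<in> G \<Longrightarrow> (x \<oplus>\<^bsub>M\<^esub> y, a \<oplus>\<^bsub>E\<^esub> b) \<in> G"
    and smult: "\<And>r x a. r \<in> carrier R \<Longrightarrow> (x, a) \<in> G \<Longrightarrow> (r \<odot>\<^bsub>M\<^esub> x, r \<odot>\<^bsub>E\<^esub> a) \<in> G"
    and null: "\<And>a. (\<zero>\<^bsub>M\<^esub>, a) \<in> G \<Longrightarrow> a = \<zero>\<^bsub>E\<^esub>"
    by (auto simp: partial_def)
  have zero: "(\<zero>\<^bsub>M\<^esub>, \<zero>\<^bsub>E\<^esub>) \<in> G"
    using graph[OF submodule_zero[OF N]] f0 by simp
  have neg: "(\<ominus>\<^bsub>M\<^esub> x, \<ominus>\<^bsub>E\<^esub> a) \<in> G" if "(x, a) \<in> G" for x a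
    using smult[OF _ that, of "\<ominus>\<^bsub>R\<^esub> \<one>\<^bsub>R\<^esub>"] sub[OF that] by (simp add: M.smult_l_minus E.smult_l_minus)
  \<comment> \<open>Subtracting the pairs puts zero together with the difference of \<open>a\<close>
    and \<open>b\<close> into \<open>G\<close>.\<close>
  have unique: "a = b" if "(x, a) \<in> G" "(x, b) \<in> G" for x a b
  proof -
    have "(\<zero>\<^bsub>M\<^esub>, a \<ominus>\<^bsub>E\<^esub> b) \<in> G"
      using add[OF that(1) neg[OF that(2)]] sub[OF that(1)] by (simp add: M.r_neg a_minus_def)
    then show ?thesis
      using null that sub E.minus_eq_zero_iff by blast
  qed
  define g where "g x = (THE a. (x, a) \<in> G)" for x
  have g: "g x = a" if "(x, a) \<in> G" for x a
    unfolding g_def using that unique by (intro the_equality)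
  have dom: "x \<in> Domain G" if x: "x \<in> carrier M" for x
  proof -
    define I where "I = {r \<in> carrier R. r \<odot>\<^bsub>M\<^esub> x \<in> Domain G}"
    have I: "submodule I R (regular_module R)"
    proof (rule module.submoduleI[OF M.regular_module_is_module])
      show "\<zero>\<^bsub>regular_module R\<^esub> \<in> I"
        using zero x by (auto simp: I_def)
      fix r s assume r: "r \<in> I"
      have "\<ominus>\<^bsub>regular_module R\<^esub> r = \<ominus>\<^bsub>R\<^esub> r"
        by (simp add: a_inv_def m_inv_def)
      then show "\<ominus>\<^bsub>regular_module R\<^esub> r \<in> I"
        using r neg x by (auto simp: I_def M.smult_l_minus)
      show "r \<oplus>\<^bsub>regular_module R\<^esub> s \<in> I" if "s \<in> I"
        using r that add x by (fastforce simp: I_def M.smult_l_distr)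
    next
      fix s r assume "s \<in> carrier R" "r \<in> I"
      then show "s \<odot>\<^bsub>regular_module R\<^esub> r \<in> I"
        using smult x by (auto simp: I_def M.smult_assoc1)
    qed (auto simp: I_def)
    have Iv: "(r \<odot>\<^bsub>M\<^esub> x, g (r \<odot>\<^bsub>M\<^esub> x)) \<in> G" if "r \<in> I" for r
      using that g by (auto simp: I_def)
    have IR: "r \<in> carrier R" if "r \<in> I" for r
      using that by (simp add: I_def)
    have "(\<lambda>r. g (r \<odot>\<^bsub>M\<^esub> x)) \<in> module_hom R (restrict_module (regular_module R) I) E"
    proof (rule module_homI, simp_all)
      fix r assume r: "r \<in> I"
      show "g (r \<odot>\<^bsub>M\<^esub> x) \<in> carrier E"
        using Iv[OF r] sub by blast
      show "g ((r \<oplus>\<^bsub>R\<^esub> s) \<odot>\<^bsub>M\<^esub> x) = g (r \<odot>\<^bsub>M\<^esub> x) \<oplus>\<^bsub>E\<^esub> g (s \<odot>\<^bsub>M\<^esub> x)" if s: "s \<in> I" for s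
        using add[OF Iv[OF r] Iv[OF s]] IR[OF r] IR[OF s] x by (intro g) (simp add: M.smult_l_distr)
      show "g (s \<otimes>\<^bsub>R\<^esub> r \<odot>\<^bsub>M\<^esub> x) = s \<odot>\<^bsub>E\<^esub> g (r \<odot>\<^bsub>M\<^esub> x)" if s: "s \<in> carrier R" for s
        using smult[OF s Iv[OF r]] IR[OF r] s x by (intro g) (simp add: M.smult_assoc1)
    qed
    with inj M.regular_module_is_module submodule.submodule_is_module[OF I M.regular_module_is_module]
      submodule_hom[OF I]
    obtain h where h: "h \<in> module_hom R (regular_module R) E"
        "\<And>r. r \<in> I \<Longrightarrow> h r = g (r \<odot>\<^bsub>M\<^esub> x)"
      by (force dest: injective_moduleD[of R E "restrict_module (regular_module R) I" "regular_module R" "\<lambda>r. r"])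
    \<comment> \<open>This is the value to be assigned to \<open>x\<close>.\<close>
    define e where "e = h \<one>\<^bsub>R\<^esub>"
    have e: "e \<in> carrier E"
      using module_homD(1)[OF h(1)] by (simp add: e_def)
    \<comment> \<open>The value \<open>e\<close> is compatible with \<open>G\<close>: wherever a
      multiple of \<open>x\<close> already lies in the domain, \<open>G\<close> assigns to it the
      same multiple of \<open>e\<close>.\<close>
    have ge: "a = r \<odot>\<^bsub>E\<^esub> e" if "r \<in> carrier R" "(r \<odot>\<^bsub>M\<^esub> x, a) \<in> G" for r a
      using that DomainI[OF that(2)] h(2)[of r] g[OF that(2)] module_homD(3)[OF h(1), of r "\<one>\<^bsub>R\<^esub>"]
      by (auto simp: I_def e_def)
    \<comment> \<open>This graph enlarges the domain by the multiples of \<open>x\<close>, with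
      \<open>x\<close> sent to \<open>e\<close>.\<close>
    define G' where "G' = {(y \<oplus>\<^bsub>M\<^esub> r \<odot>\<^bsub>M\<^esub> x, b \<oplus>\<^bsub>E\<^esub> r \<odot>\<^bsub>E\<^esub> e) | y b r. (y, b) \<in> G \<and> r \<in> carrier R}"
    have G'I: "(u, c) \<in> G'" if "(y, b) \<in> G" "r \<in> carrier R" "u = y \<oplus>\<^bsub>M\<^esub> r \<odot>\<^bsub>M\<^esub> x" "c = b \<oplus>\<^bsub>E\<^esub> r \<odot>\<^bsub>E\<^esub> e"
      for u c y b r
      using that by (auto simp: G'_def)
    have GG': "G \<subseteq> G'"
    proof (clarify)
      fix y b assume "(y, b) \<in> G"
      then show "(y, b) \<in> G'"
        using sub[of y b] x e by (intro G'I[of y b "\<zero>\<^bsub>R\<^esub>"]) auto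
    qed
    have "partial G'"
      unfolding partial_def
    proof (intro conjI allI impI)
      show "G' \<subseteq> carrier M \<times> carrier E"
        using sub x e by (auto simp: G'_def)
      show "(\<lambda>x. (x, f x)) ` N \<subseteq> G'"
        using graph GG' by auto
      fix u c assume "(u, c) \<in> G'"
      then obtain y b r where y: "(y, b) \<in> G" "r \<in> carrier R" "u = y \<oplus>\<^bsub>M\<^esub> r \<odot>\<^bsub>M\<^esub> x"
          "c = b \<oplus>\<^bsub>E\<^esub> r \<odot>\<^bsub>E\<^esub> e"
        by (auto simp: G'_def)
      note yb = sub[OF y(1)]
      show "(u \<oplus>\<^bsub>M\<^esub> v, c \<oplus>\<^bsub>E\<^esub> d) \<in> G'" if "(v, d) \<in> G'" for v d
      proof -
        obtain z a s where z: "(z, a) \<in> G" "s \<in> carrier R" "v = z \<oplus>\<^bsub>M\<^esub> s \<odot>\<^bsub>M\<^esub> x"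
            "d = a \<oplus>\<^bsub>E\<^esub> s \<odot>\<^bsub>E\<^esub> e"
          using \<open>(v, d) \<in> G'\<close> by (auto simp: G'_def)
        show ?thesis
          using y yb z sub[OF z(1)] x e add[OF y(1) z(1)]
          by (intro G'I[of "y \<oplus>\<^bsub>M\<^esub> z" "b \<oplus>\<^bsub>E\<^esub> a" "r \<oplus>\<^bsub>R\<^esub> s"])
            (auto simp: M.smult_l_distr E.smult_l_distr M.a_ac E.a_ac)
      qed
      show "(s \<odot>\<^bsub>M\<^esub> u, s \<odot>\<^bsub>E\<^esub> c) \<in> G'" if s: "s \<in> carrier R" for s
        using y yb s x e smult[OF s y(1)]
        by (intro G'I[of "s \<odot>\<^bsub>M\<^esub> y" "s \<odot>\<^bsub>E\<^esub> b" "s \<otimes>\<^bsub>R\<^esub> r"])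
          (auto simp: M.smult_r_distr E.smult_r_distr M.smult_assoc1 E.smult_assoc1)
    next
      fix c assume "(\<zero>\<^bsub>M\<^esub>, c) \<in> G'"
      then obtain y b r where y: "(y, b) \<in> G" "r \<in> carrier R" "\<zero>\<^bsub>M\<^esub> = y \<oplus>\<^bsub>M\<^esub> r \<odot>\<^bsub>M\<^esub> x"
          "c = b \<oplus>\<^bsub>E\<^esub> r \<odot>\<^bsub>E\<^esub> e"
        by (auto simp: G'_def)
      note yb = sub[OF y(1)]
      \<comment> \<open>If zero is the sum of \<open>y\<close> and a multiple of \<open>x\<close>,
        that multiple is the negative of \<open>y\<close> and hence lies in the domain of
        \<open>G\<close>. Compatibility of \<open>e\<close> with \<open>G\<close> then makes the two
        contributions to \<open>c\<close> cancel.\<close>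
      have "\<ominus>\<^bsub>M\<^esub> y = r \<odot>\<^bsub>M\<^esub> x"
        using y yb x by (intro M.minus_equality) (auto simp: M.a_comm)
      then have "\<ominus>\<^bsub>E\<^esub> b = r \<odot>\<^bsub>E\<^esub> e"
        using ge[OF y(2)] neg[OF y(1)] by simp
      then show "c = \<zero>\<^bsub>E\<^esub>"
        using y(4) yb by (simp add: E.r_neg flip: \<open>\<ominus>\<^bsub>E\<^esub> b = r \<odot>\<^bsub>E\<^esub> e\<close>)
    qed
    \<comment> \<open>By maximality the enlargement adds nothing, so \<open>x\<close> was in the
      domain of \<open>G\<close> all along.\<close>
    then have "G' = G"
      using max GG' by blast
    moreover have "(x, e) \<in> G'"
      using x e zero by (intro G'I[of "\<zero>\<^bsub>M\<^esub>" "\<zero>\<^bsub>E\<^esub>" "\<one>\<^bsub>R\<^esub>"]) auto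
    ultimately show ?thesis
      by auto
  qed
  have gv: "(x, g x) \<in> G" if "x \<in> carrier M" for x
    using dom[OF that] g by auto
  show thesis
  proof
    show "g \<in> module_hom R M E"
      using sub[OF gv] g[OF add[OF gv gv]] g[OF smult[OF _ gv]] by (intro module_homI) auto
    show "g x = f x" if "x \<in> N" for x
      using g[OF graph[OF that]] .
  qed
qed


section \<open>Duals\<close>

lemma dual_iff:
  "f \<in> carrier (matlis_dual R E M) \<longleftrightarrow> f \<in> module_hom R M E \<and> f \<in> extensional (carrier M)"
  by (simp add: matlis_dual_def)

lemma dual_hom: "f \<in> carrier (matlis_dual R E M) \<Longrightarrow> f \<in> module_hom R M E"
  by (simp add: dual_iff)

lemma dual_eqI:
  assumes "f \<in> carrier (matlis_dual R E M)" "g \<in> carrier (matlis_dual R E M)"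
    and "\<And>x. x \<in> carrier M \<Longrightarrow> f x = g x"
  shows "f = g"
  using assms by (intro extensionalityI[of f "carrier M" g]) (auto simp: dual_iff)

lemma dual_apply [simp]:
  "x \<in> carrier M \<Longrightarrow> (f \<oplus>\<^bsub>matlis_dual R E M\<^esub> g) x = f x \<oplus>\<^bsub>E\<^esub> g x"
  "x \<in> carrier M \<Longrightarrow> (r \<odot>\<^bsub>matlis_dual R E M\<^esub> f) x = r \<odot>\<^bsub>E\<^esub> f x"
  "x \<in> carrier M \<Longrightarrow> \<zero>\<^bsub>matlis_dual R E M\<^esub> x = \<zero>\<^bsub>E\<^esub>"
  by (simp_all add: matlis_dual_def)

lemma dual_restrict:
  assumes "f \<in> module_hom R M E" "module R M"
  shows "restrict f (carrier M) \<in> carrier (matlis_dual R E M)"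
proof -
  interpret M: module R M by fact
  show ?thesis
    using module_homD[OF assms(1)] by (auto simp: dual_iff intro!: module_homI)
qed

lemma dual_module:
  assumes M: "module R M" and E: "module R E"
  shows "module R (matlis_dual R E M)" (is "module R ?D")
proof -
  interpret M: module R M by fact
  interpret E: module R E by fact
  have app: "f x \<in> carrier E" if "f \<in> carrier ?D" "x \<in> carrier M" for f x
    by (rule module_homD(1)[OF dual_hom]) fact+
  have add: "f \<oplus>\<^bsub>?D\<^esub> g \<in> carrier ?D" if f: "f \<in> carrier ?D" and g: "g \<in> carrier ?D" for f g
  proof -
    have "(\<lambda>x. f x \<oplus>\<^bsub>E\<^esub> g x) \<in> module_hom R M E"
      using module_homD[OF dual_hom[OF f]] module_homD[OF dual_hom[OF g]]
      by (intro module_homI) (simp_all add: E.a_ac E.smult_r_distr)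
    then show ?thesis
      using dual_restrict[OF _ M] by (simp add: matlis_dual_def)
  qed
  have smult: "r \<odot>\<^bsub>?D\<^esub> f \<in> carrier ?D" if r: "r \<in> carrier R" and f: "f \<in> carrier ?D" for r f
  proof -
    \<comment> \<open>Commutativity of \<open>R\<close> is what makes a scalar multiple of a
      homomorphism linear again.\<close>
    have "r \<odot>\<^bsub>E\<^esub> (s \<odot>\<^bsub>E\<^esub> a) = s \<odot>\<^bsub>E\<^esub> (r \<odot>\<^bsub>E\<^esub> a)" if "s \<in> carrier R" "a \<in> carrier E" for s a
      using that r by (metis E.smult_assoc1 M.m_comm)
    then have "(\<lambda>x. r \<odot>\<^bsub>E\<^esub> f x) \<in> module_hom R M E"
      using module_homD[OF dual_hom[OF f]] r
      by (intro module_homI) (simp_all add: E.smult_r_distr)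
    then show ?thesis
      using dual_restrict[OF _ M] by (simp add: matlis_dual_def)
  qed
  have "(\<lambda>x. \<zero>\<^bsub>E\<^esub>) \<in> module_hom R M E"
    by (intro module_homI) simp_all
  then have zero: "\<zero>\<^bsub>?D\<^esub> \<in> carrier ?D"
    using dual_restrict[OF _ M] by (simp add: matlis_dual_def)
  show ?thesis
  proof (intro moduleI abelian_groupI M.is_cring)
    fix f assume f: "f \<in> carrier ?D"
    have "(\<ominus>\<^bsub>R\<^esub> \<one>\<^bsub>R\<^esub>) \<odot>\<^bsub>?D\<^esub> f \<oplus>\<^bsub>?D\<^esub> f = \<zero>\<^bsub>?D\<^esub>"
      using f app[OF f] by (intro dual_eqI[of _ R E M] add smult zero) (auto simp: E.smult_l_minus E.l_neg)
    then show "\<exists>g\<in>carrier ?D. g \<oplus>\<^bsub>?D\<^esub> f = \<zero>\<^bsub>?D\<^esub>"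
      using smult[OF _ f] by blast
    show "\<one>\<^bsub>R\<^esub> \<odot>\<^bsub>?D\<^esub> f = f" "\<zero>\<^bsub>?D\<^esub> \<oplus>\<^bsub>?D\<^esub> f = f"
      using f app[OF f] by (intro dual_eqI[of _ R E M] add smult zero, auto)+
    {
      fix r s assume rs: "r \<in> carrier R" "s \<in> carrier R"
      show "(r \<oplus>\<^bsub>R\<^esub> s) \<odot>\<^bsub>?D\<^esub> f = r \<odot>\<^bsub>?D\<^esub> f \<oplus>\<^bsub>?D\<^esub> s \<odot>\<^bsub>?D\<^esub> f"
        using f rs app[OF f] by (intro dual_eqI[of _ R E M] add smult) (auto simp: E.smult_l_distr)
      show "(r \<otimes>\<^bsub>R\<^esub> s) \<odot>\<^bsub>?D\<^esub> f = r \<odot>\<^bsub>?D\<^esub> (s \<odot>\<^bsub>?D\<^esub> f)"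
        using f rs app[OF f] by (intro dual_eqI[of _ R E M] add smult) (auto simp: E.smult_assoc1)
    }
    fix g assume g: "g \<in> carrier ?D"
    show "f \<oplus>\<^bsub>?D\<^esub> g = g \<oplus>\<^bsub>?D\<^esub> f"
      using f g app[OF f] app[OF g] by (intro dual_eqI[of _ R E M] add) (auto simp: E.a_comm)
    show "r \<odot>\<^bsub>?D\<^esub> (f \<oplus>\<^bsub>?D\<^esub> g) = r \<odot>\<^bsub>?D\<^esub> f \<oplus>\<^bsub>?D\<^esub> r \<odot>\<^bsub>?D\<^esub> g" if "r \<in> carrier R" for r
      using that f g app[OF f] app[OF g]
      by (intro dual_eqI[of _ R E M] add smult) (auto simp: E.smult_r_distr)
    fix h assume h: "h \<in> carrier ?D"
    show "f \<oplus>\<^bsub>?D\<^esub> g \<oplus>\<^bsub>?D\<^esub> h = f \<oplus>\<^bsub>?D\<^esub> (g \<oplus>\<^bsub>?D\<^esub> h)"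
      using f g h app[OF f] app[OF g] app[OF h]
      by (intro dual_eqI[of _ R E M] add) (auto simp: E.a_assoc)
  qed (use add smult zero in auto)
qed

section \<open>Duals of homomorphisms\<close>

lemma dual_map_apply [simp]: "x \<in> carrier M \<Longrightarrow> dual_map M \<phi> f x = f (\<phi> x)"
  by (simp add: dual_map_def)

lemma dual_map_hom:
  assumes \<phi>: "\<phi> \<in> module_hom R M N" and M: "module R M" and N: "module R N" and E: "module R E"
  shows "dual_map M \<phi> \<in> module_hom R (matlis_dual R E N) (matlis_dual R E M)"
proof -
  interpret DM: module R "matlis_dual R E M" by (rule dual_module) fact+
  interpret DN: module R "matlis_dual R E N" by (rule dual_module) fact+
  have cl: "dual_map M \<phi> f \<in> carrier (matlis_dual R E M)" if "f \<in> carrier (matlis_dual R E N)" for f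
    using dual_restrict[OF module_hom_comp[OF \<phi> dual_hom[OF that]] M] by (simp add: dual_map_def)
  note \<phi> = module_homD[OF \<phi>]
  show ?thesis
  proof (rule module_homI)
    fix f assume f: "f \<in> carrier (matlis_dual R E N)"
    show "dual_map M \<phi> (f \<oplus>\<^bsub>matlis_dual R E N\<^esub> g)
        = dual_map M \<phi> f \<oplus>\<^bsub>matlis_dual R E M\<^esub> dual_map M \<phi> g"
      if g: "g \<in> carrier (matlis_dual R E N)" for g
      using f g \<phi> by (intro dual_eqI[of _ R E M] cl DM.a_closed DN.a_closed) auto
    show "dual_map M \<phi> (r \<odot>\<^bsub>matlis_dual R E N\<^esub> f) = r \<odot>\<^bsub>matlis_dual R E M\<^esub> dual_map M \<phi> f"
      if "r \<in> carrier R" for r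
      using f that \<phi> by (intro dual_eqI[of _ R E M] cl DM.smult_closed DN.smult_closed) auto
  qed (rule cl)
qed

lemma dual_map_inj_on:
  assumes "p ` carrier M = carrier N"
  shows "inj_on (dual_map M p) (carrier (matlis_dual R E N))"
proof (rule inj_onI)
  fix f g assume fg: "f \<in> carrier (matlis_dual R E N)" "g \<in> carrier (matlis_dual R E N)"
    and eq: "dual_map M p f = dual_map M p g"
  have "f (p x) = g (p x)" if "x \<in> carrier M" for x
    using that fun_cong[OF eq, of x] by simp
  then show "f = g"
    using fg by (intro dual_eqI[of f R E N g]) (auto simp flip: assms)
qed

lemma dual_map_factor:
  assumes "p \<in> module_hom R M N" "p ` carrier M = carrier N" "module R M" "module R N" "module R E"
    and f: "f \<in> carrier (matlis_dual R E M)"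
    and ker: "\<And>x. x \<in> carrier M \<Longrightarrow> p x = \<zero>\<^bsub>N\<^esub> \<Longrightarrow> f x = \<zero>\<^bsub>E\<^esub>"
  shows "f \<in> dual_map M p ` carrier (matlis_dual R E N)"
proof -
  obtain g where g: "g \<in> module_hom R N E" "g \<in> extensional (carrier N)"
      "\<And>x. x \<in> carrier M \<Longrightarrow> g (p x) = f x"
    using module_hom_factor[OF assms(1) dual_hom[OF f] assms(3-5,2) ker] by metis
  then have gN: "g \<in> carrier (matlis_dual R E N)"
    by (simp add: dual_iff)
  moreover have "dual_map M p g = f"
    using module_homD(1)[OF dual_map_hom[OF assms(1,3-5)] gN] g(3)
    by (intro dual_eqI[OF _ f]) auto
  ultimately show ?thesis
    by (metis image_eqI)
qed

text \<open>A functional on \<open>M\<close> descends to \<open>N\<close> exactly when it kills the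
  kernel of \<open>p\<close>. This places annihilators of submodules in the dual class and turns the
  dual of a surjection into an inclusion up to isomorphism.\<close>

lemma dual_map_iso_annihilator:
  assumes "p \<in> module_hom R M N" "p ` carrier M = carrier N" "module R M" "module R N" "module R E"
  shows "dual_map M p \<in> module_iso R (matlis_dual R E N) (restrict_module (matlis_dual R E M)
    {f \<in> carrier (matlis_dual R E M). \<forall>x\<in>carrier M. p x = \<zero>\<^bsub>N\<^esub> \<longrightarrow> f x = \<zero>\<^bsub>E\<^esub>})"
proof (rule module_isoI)
  note hom = module_homD[OF dual_map_hom[OF assms(1,3-5)]]
  have "f \<zero>\<^bsub>N\<^esub> = \<zero>\<^bsub>E\<^esub>" if "f \<in> carrier (matlis_dual R E N)" for f
    using module_hom_zero[OF dual_hom[OF that] assms(4,5)] .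
  then show "dual_map M p \<in> module_hom R (matlis_dual R E N) (restrict_module (matlis_dual R E M)
    {f \<in> carrier (matlis_dual R E M). \<forall>x\<in>carrier M. p x = \<zero>\<^bsub>N\<^esub> \<longrightarrow> f x = \<zero>\<^bsub>E\<^esub>})"
    using hom by (intro module_homI) auto
  show "inj_on (dual_map M p) (carrier (matlis_dual R E N))"
    by (rule dual_map_inj_on) fact
qed (auto intro!: dual_map_factor[OF assms])

lemma dual_map_iso:
  assumes "\<phi> \<in> module_iso R M N" "module R M" "module R N" "module R E"
  shows "dual_map M \<phi> \<in> module_iso R (matlis_dual R E N) (matlis_dual R E M)"
proof (rule module_isoI[OF dual_map_hom dual_map_inj_on])
  note hom = module_iso_hom[OF assms(1)] and im = module_iso_image[OF assms(1)]
  show "carrier (matlis_dual R E M) \<subseteq> dual_map M \<phi> ` carrier (matlis_dual R E N)"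
  proof
    fix f assume f: "f \<in> carrier (matlis_dual R E M)"
    \<comment> \<open>The kernel of \<phi> is zero, so the factoring criterion holds for every
      functional.\<close>
    have "f x = \<zero>\<^bsub>E\<^esub>" if "x \<in> carrier M" "\<phi> x = \<zero>\<^bsub>N\<^esub>" for x
    proof -
      have "\<zero>\<^bsub>M\<^esub> \<in> carrier M"
        using submodule_zero[OF module.carrier_is_submodule[OF assms(2)]] .
      then have "x = \<zero>\<^bsub>M\<^esub>"
        using that module_hom_zero[OF hom assms(2,3)] module_iso_inj[OF assms(1)]
        by (auto simp: inj_on_def)
      then show ?thesis
        using module_hom_zero[OF dual_hom[OF f] assms(2,4)] by simp
    qed
    then show "f \<in> dual_map M \<phi> ` carrier (matlis_dual R E N)"
      by (rule dual_map_factor[OF hom im assms(2-4) f])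
  qed
qed (use assms module_iso_hom[OF assms(1)] module_iso_image[OF assms(1)] in simp_all)

text \<open>Injectivity of \<open>E\<close> extends each functional on \<open>N\<close> to one on
  \<open>M\<close>.\<close>

lemma dual_map_restriction_surj:
  assumes inj: "injective_module R E" and M: "module R M" and N: "submodule N R M"
  shows "dual_map (restrict_module M N) (\<lambda>x. x) ` carrier (matlis_dual R E M)
    = carrier (matlis_dual R E (restrict_module M N))"
proof -
  have E: "module R E"
    using inj by (simp add: injective_module_def)
  have N': "module R (restrict_module M N)"
    by (rule submodule.submodule_is_module) fact+
  note hom = module_homD(1)[OF dual_map_hom[OF submodule_hom[OF N] N' M E]]
  have "f \<in> dual_map (restrict_module M N) (\<lambda>x. x) ` carrier (matlis_dual R E M)"
    if f: "f \<in> carrier (matlis_dual R E (restrict_module M N))" for f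
  proof -
    obtain g where g: "g \<in> module_hom R M E" "\<And>x. x \<in> N \<Longrightarrow> g x = f x"
      using injective_module_extend[OF inj M N dual_hom[OF f]] by metis
    let ?g = "restrict g (carrier M)"
    have "?g \<in> carrier (matlis_dual R E M)"
      by (rule dual_restrict[OF g(1) M])
    moreover from this have "dual_map (restrict_module M N) (\<lambda>x. x) ?g = f"
      using g(2) submodule_subset[OF N] by (intro dual_eqI[OF hom f]) auto
    ultimately show ?thesis
      by (metis image_eqI)
  qed
  then show ?thesis
    using hom by auto
qed

section \<open>The natural map to the bidual\<close>

lemma bidual_map_apply [simp]: "f \<in> carrier (matlis_dual R E M) \<Longrightarrow> bidual_map R E M x f = f x"
  by (simp add: bidual_map_def)

lemma bidual_map_closed:
  assumes "x \<in> carrier M" "module R M" "module R E"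
  shows "bidual_map R E M x \<in> carrier (matlis_dual R E (matlis_dual R E M))"
proof -
  have "(\<lambda>f. f x) \<in> module_hom R (matlis_dual R E M) E"
    using assms(1) by (intro module_homI) (auto intro: module_homD(1)[OF dual_hom])
  then show ?thesis
    using dual_restrict[OF _ dual_module[OF assms(2,3)]] by (simp add: bidual_map_def)
qed

lemma matlis_dualizable_module: "matlis_dualizable R E M \<Longrightarrow> module R M"
  and matlis_dualizable_iso: "matlis_dualizable R E M \<Longrightarrow>
    bidual_map R E M \<in> module_iso R M (matlis_dual R E (matlis_dual R E M))"
  by (simp_all add: matlis_dualizable_def)

lemma bidual_map_hom:
  assumes "module R M" "module R E"
  shows "bidual_map R E M \<in> module_hom R M (matlis_dual R E (matlis_dual R E M))"
proof -
  interpret M: module R M by fact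
  interpret DD: module R "matlis_dual R E (matlis_dual R E M)"
    by (intro dual_module assms)
  note hom = module_homD[OF dual_hom]
  show ?thesis
    using bidual_map_closed[OF _ assms]
    by (intro module_homI)
      (auto intro!: dual_eqI[of _ R E "matlis_dual R E M"] simp: hom(2,3)[of _ R E M])
qed

text \<open>Evaluation at \<open>x\<close> and evaluation at zero are the same element of the
  bidual, and the natural map is injective.\<close>

lemma matlis_dualizable_separates:
  assumes M: "matlis_dualizable R E M" and E: "module R E" and x: "x \<in> carrier M"
    and zero: "\<And>f. f \<in> carrier (matlis_dual R E M) \<Longrightarrow> f x = \<zero>\<^bsub>E\<^esub>"
  shows "x = \<zero>\<^bsub>M\<^esub>"
proof -
  note mod = matlis_dualizable_module[OF M]
  have z: "\<zero>\<^bsub>M\<^esub> \<in> carrier M"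
    using submodule_zero[OF module.carrier_is_submodule[OF mod]] .
  have "f \<zero>\<^bsub>M\<^esub> = \<zero>\<^bsub>E\<^esub>" if "f \<in> carrier (matlis_dual R E M)" for f
    using module_hom_zero[OF dual_hom[OF that] mod E] .
  then have "bidual_map R E M x = bidual_map R E M \<zero>\<^bsub>M\<^esub>"
    by (intro dual_eqI[OF bidual_map_closed[OF x mod E] bidual_map_closed[OF z mod E]])
      (simp add: zero)
  then show ?thesis
    using module_iso_inj[OF matlis_dualizable_iso[OF M]] x z by (auto simp: inj_on_def)
qed

text \<open>The natural map of the dual is inverse to the dual of the natural map of
  \<open>M\<close>. The lemma allows the smile dual of the smile dual to be computed by the same
  formula as the smile dual itself.\<close>

lemma matlis_dualizable_dual:
  assumes M: "matlis_dualizable R E M" and E: "module R E"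
  shows "matlis_dualizable R E (matlis_dual R E M)"
proof -
  let ?D = "matlis_dual R E M" and ?b = "bidual_map R E"
  note mod = matlis_dualizable_module[OF M]
  note iso = matlis_dualizable_iso[OF M]
  have D: "module R ?D" and DD: "module R (matlis_dual R E ?D)"
    by (intro dual_module mod E)+
  have "inj_on (?b ?D) (carrier ?D)"
  proof (rule inj_onI)
    fix f g assume fg: "f \<in> carrier ?D" "g \<in> carrier ?D" "?b ?D f = ?b ?D g"
    have "f x = g x" if "x \<in> carrier M" for x
      using fun_cong[OF fg(3), of "?b M x"] bidual_map_closed[OF that mod E] fg(1,2) by simp
    then show "f = g"
      using fg by (intro dual_eqI[of f R E M g])
  qed
  moreover have "F \<in> ?b ?D ` carrier ?D" if F: "F \<in> carrier (matlis_dual R E (matlis_dual R E ?D))" for F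
  proof -
    \<comment> \<open>The preimage of \<open>F\<close> is its composite with the natural map of
      \<open>M\<close>. To compare both sides it is enough to test on evaluations at points of
      \<open>M\<close>, as these exhaust the bidual.\<close>
    let ?f = "dual_map M (?b M) F"
    have f: "?f \<in> carrier ?D"
      using module_homD(1)[OF dual_map_hom[OF module_iso_hom[OF iso] mod DD E] F] .
    have "?b ?D ?f = F"
    proof (rule dual_eqI[OF bidual_map_closed[OF f D E] F])
      fix \<xi> assume \<xi>: "\<xi> \<in> carrier (matlis_dual R E ?D)"
      then obtain x where "x \<in> carrier M" "\<xi> = ?b M x"
        using module_iso_image[OF iso] by auto
      then show "?b ?D ?f \<xi> = F \<xi>"
        using \<xi> f by simp
    qed
    then show ?thesis
      using f by (metis image_eqI)
  qed
  ultimately show ?thesis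
    unfolding matlis_dualizable_def
    using D module_isoI[OF bidual_map_hom[OF D E]] by blast
qed


section \<open>Submodule selectors and smile duals\<close>

text \<open>Two isomorphisms from \<open>X\<close> to members \<open>N'\<close> and \<open>N\<close>
  differ by the isomorphism \<open>?\<chi>\<close> between these members, which carries the selected
  submodule of one to that of the other.\<close>

lemma selector_at_eq:
  assumes sel: "submodule_selector R \<M> \<alpha>" and X: "module R X" and N: "N \<in> \<M>"
    and \<psi>: "\<psi> \<in> module_iso R X N"
  shows "selector_at R \<M> \<alpha> X = {x \<in> carrier X. \<psi> x \<in> \<alpha> N}"
proof -
  have "\<psi> x \<in> \<alpha> N"
    if x: "x \<in> carrier X" "N' \<in> \<M>" "\<phi> \<in> module_iso R X N'" "\<phi> x \<in> \<alpha> N'" for x N' \<phi>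
  proof -
    let ?\<chi> = "\<lambda>y. \<psi> (inv_into (carrier X) \<phi> y)"
    have "?\<chi> \<in> module_iso R N' N"
      by (rule module_iso_comp[OF module_iso_inv[OF x(3) X] \<psi>])
    then have "?\<chi> ` \<alpha> N' = \<alpha> N"
      using sel x(2) N by (simp add: submodule_selector_def)
    moreover have "?\<chi> (\<phi> x) = \<psi> x"
      using module_iso_inj[OF x(3)] x(1) by simp
    ultimately show ?thesis
      using x(4) by (metis image_eqI)
  qed
  then show ?thesis
    using N \<psi> by (auto simp: selector_at_def)
qed

lemma selectorD:
  assumes "submodule_selector R \<M> \<alpha>" "M \<in> \<M>"
  shows "submodule (\<alpha> M) R M" "restrict_module M (\<alpha> M) \<in> \<M>" "\<alpha> M \<subseteq> carrier M"
  using assms submodule_subset by (auto simp: submodule_selector_def)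

text \<open>This version takes the isomorphism out of the member of the class, the direction in
  which the natural map of a dualizable module points.\<close>

lemma selector_at_image:
  assumes sel: "submodule_selector R \<M> \<alpha>" and X: "module R X" and N: "N \<in> \<M>" "module R N"
    and \<theta>: "\<theta> \<in> module_iso R N X"
  shows "selector_at R \<M> \<alpha> X = \<theta> ` \<alpha> N"
proof -
  note sub = selectorD(3)[OF sel N(1)] and im = module_iso_image[OF \<theta>]
  have inv: "inv_into (carrier N) \<theta> (\<theta> y) = y" if "y \<in> carrier N" for y
    using that module_iso_inj[OF \<theta>] by simp
  show ?thesis
    unfolding selector_at_eq[OF sel X N(1) module_iso_inv[OF \<theta> N(2)]]
    using sub inv by (auto simp flip: im intro!: imageI)
qed

text \<open>Functionals on the quotient of \<open>?D\<close> by \<open>A\<close> are the functionals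
  on \<open>?D\<close> that vanish on \<open>A\<close>. Evaluation at \<open>x\<close> is one of
  these iff every member of \<open>A\<close> vanishes at \<open>x\<close>.\<close>

lemma smile_dual_eq_annihilator:
  assumes X: "module R X" and E: "module R E"
    and A: "selector_at R \<M> \<alpha> (matlis_dual R E X) = A" "submodule A R (matlis_dual R E X)"
  shows "smile_dual R E \<M> \<alpha> X = {x \<in> carrier X. \<forall>f\<in>A. f x = \<zero>\<^bsub>E\<^esub>}"
proof -
  let ?D = "matlis_dual R E X"
  let ?Q = "quotient_module ?D A" and ?p = "\<lambda>f. A +>\<^bsub>?D\<^esub> f"
  have D: "module R ?D"
    by (rule dual_module) fact+
  note Q = quotient_module_is_module[OF D A(2)]
  note p = quotient_module_proj[OF D A(2)] and surj = quotient_module_surj[OF D A(2)]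
  note ker = quotient_module_coset_eq[OF D A(2)]
  have "bidual_map R E X x \<in> dual_map ?D ?p ` carrier (matlis_dual R E ?Q) \<longleftrightarrow> (\<forall>f\<in>A. f x = \<zero>\<^bsub>E\<^esub>)"
    if x: "x \<in> carrier X" for x
  proof
    assume "bidual_map R E X x \<in> dual_map ?D ?p ` carrier (matlis_dual R E ?Q)"
    then obtain g where g: "g \<in> carrier (matlis_dual R E ?Q)" "bidual_map R E X x = dual_map ?D ?p g"
      by auto
    show "\<forall>f\<in>A. f x = \<zero>\<^bsub>E\<^esub>"
    proof
      fix f assume f: "f \<in> A"
      then have fD: "f \<in> carrier ?D"
        using submodule_subset[OF A(2)] by auto
      have "f x = g (?p f)"
        using fun_cong[OF g(2), of f] fD by simp
      also have "\<dots> = g A"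
        using ker[OF fD] f by simp
      also have "\<dots> = \<zero>\<^bsub>E\<^esub>"
        using module_hom_zero[OF dual_hom[OF g(1)] Q E] by (simp add: quotient_module_zero[OF D A(2)])
      finally show "f x = \<zero>\<^bsub>E\<^esub>" .
    qed
  next
    assume ann: "\<forall>f\<in>A. f x = \<zero>\<^bsub>E\<^esub>"
    have "bidual_map R E X x f = \<zero>\<^bsub>E\<^esub>" if "f \<in> carrier ?D" "?p f = \<zero>\<^bsub>?Q\<^esub>" for f
      using that ann ker[OF that(1)] by (simp add: quotient_module_zero[OF D A(2)])
    then show "bidual_map R E X x \<in> dual_map ?D ?p ` carrier (matlis_dual R E ?Q)"
      by (rule dual_map_factor[OF p surj D Q E bidual_map_closed[OF x X E]])
  qed
  then show ?thesis
    by (auto simp: smile_dual_def Let_def A(1))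
qed

lemma smile_dual_eq:
  assumes E: "module R E" and sel: "submodule_selector R \<M> \<alpha>"
    and M: "M \<in> \<M>" "matlis_dualizable R E M"
    and X: "module R X" and \<phi>: "\<phi> \<in> module_iso R X (matlis_dual R E M)"
  shows "smile_dual R E \<M> \<alpha> X = {x \<in> carrier X. \<forall>m\<in>\<alpha> M. \<phi> x m = \<zero>\<^bsub>E\<^esub>}"
proof -
  \<comment> \<open>Evaluation at \<open>m\<close>, precomposed with \<phi>, identifies
    \<open>M\<close> with the dual of \<open>X\<close>. Its value at \<open>x\<close> is
    \<open>\<phi> x m\<close>, so the annihilator of the image of \<open>\<alpha> M\<close> takes
    the asserted form.\<close>
  let ?\<theta> = "\<lambda>m. dual_map X \<phi> (bidual_map R E M m)"
  note mod = matlis_dualizable_module[OF M(2)]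
  have \<theta>: "?\<theta> \<in> module_iso R M (matlis_dual R E X)"
    using X E mod \<phi> by (intro module_iso_comp[OF matlis_dualizable_iso[OF M(2)]] dual_map_iso dual_module)
  have DX: "module R (matlis_dual R E X)"
    by (rule dual_module) fact+
  have "?\<theta> m x = \<phi> x m" if "x \<in> carrier X" for m x
    using that module_homD(1)[OF module_iso_hom[OF \<phi>]] by simp
  then show ?thesis
    using smile_dual_eq_annihilator[OF X E selector_at_image[OF sel DX M(1) mod \<theta>]
      submodule_image[OF module_iso_hom[OF \<theta>] mod DX selectorD(1)[OF sel M(1)]]]
    by auto
qed

section \<open>Selectors on a class of dualizable modules closed under quotients\<close>

locale dualizable_selector =
  fixes R :: "('r, 's) ring_scheme" and E :: "('r, 'e) module"
    and \<M> :: "('r, 'm) module set" and \<alpha> :: "('r, 'm) selector"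
  assumes inj: "injective_module R E"
    and cls: "module_class R \<M>"
    and dualizable: "\<And>M. M \<in> \<M> \<Longrightarrow> matlis_dualizable R E M"
    and quotients: "closed_under_quotients R \<M>"
    and selector: "submodule_selector R \<M> \<alpha>"
begin

text \<open>The carrier type \<open>'m \<Rightarrow> 'e\<close> is the one on which the dual of each
  member of the class is built, so these duals belong to the dual class as they stand.\<close>

abbreviation dual_modules :: "('r, 'm \<Rightarrow> 'e) module set" where
  "dual_modules \<equiv> dual_class R E \<M>"

abbreviation \<alpha>s :: "('r, 'm \<Rightarrow> 'e) selector" where
  "\<alpha>s \<equiv> smile_dual R E \<M> \<alpha>"

lemma E: "module R E"
  using inj by (simp add: injective_module_def)

lemma class_module: "M \<in> \<M> \<Longrightarrow> module R M"
  using dualizable matlis_dualizable_module by blast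

lemma dual_in: "M \<in> \<M> \<Longrightarrow> matlis_dual R E M \<in> dual_modules"
  using dual_module[OF class_module E] module_iso_id[of R] by (force simp: dual_class_def)

lemma dual_modulesE:
  assumes "X \<in> dual_modules"
  obtains M \<phi> where "M \<in> \<M>" "module R X" "\<phi> \<in> module_iso R X (matlis_dual R E M)"
  using assms by (auto simp: dual_class_def)

lemma iso_in: "M \<in> \<M> \<Longrightarrow> module R N \<Longrightarrow> \<phi> \<in> module_iso R M N \<Longrightarrow> N \<in> \<M>"
  using cls unfolding module_class_def by blast

text \<open>The quotient consists of cosets and so has another carrier type. A copy in the class
  replaces it, remembered only through a surjection with kernel \<open>K\<close>.\<close>

lemma quotient_in:
  assumes M: "M \<in> \<M>" and K: "submodule K R M"
  obtains N p where "N \<in> \<M>" "p \<in> module_hom R M N" "p ` carrier M = carrier N"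
    "\<And>x. x \<in> carrier M \<Longrightarrow> p x = \<zero>\<^bsub>N\<^esub> \<longleftrightarrow> x \<in> K"
proof -
  note mM = class_module[OF M]
  let ?Q = "quotient_module M K"
  have "in_class R \<M> ?Q"
    using quotients M K by (simp add: closed_under_quotients_def)
  then obtain N \<psi> where N: "N \<in> \<M>" and \<psi>: "\<psi> \<in> module_iso R ?Q N"
    by (auto simp: in_class_def)
  note mQ = quotient_module_is_module[OF mM K] and zQ = quotient_module_zero[OF mM K]
  note q = quotient_module_proj[OF mM K] and surj = quotient_module_surj[OF mM K]
  have "\<psi> (K +>\<^bsub>M\<^esub> x) = \<zero>\<^bsub>N\<^esub> \<longleftrightarrow> x \<in> K" if x: "x \<in> carrier M" for x
  proof -
    have "\<psi> K = \<zero>\<^bsub>N\<^esub>"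
      using module_hom_zero[OF module_iso_hom[OF \<psi>] mQ class_module[OF N]] zQ by simp
    moreover have "K +>\<^bsub>M\<^esub> x \<in> carrier ?Q" "K \<in> carrier ?Q"
      using module_homD(1)[OF q x] submodule_zero[OF module.carrier_is_submodule[OF mQ]] zQ by auto
    ultimately have "\<psi> (K +>\<^bsub>M\<^esub> x) = \<zero>\<^bsub>N\<^esub> \<longleftrightarrow> K +>\<^bsub>M\<^esub> x = K"
      using inj_on_eq_iff[OF module_iso_inj[OF \<psi>]] by metis
    then show ?thesis
      using quotient_module_coset_eq[OF mM K x] by simp
  qed
  moreover have "(\<lambda>x. \<psi> (K +>\<^bsub>M\<^esub> x)) ` carrier M = carrier N"
    using surj module_iso_image[OF \<psi>] by (metis image_image)
  ultimately show thesis
    using that N module_hom_comp[OF q module_iso_hom[OF \<psi>]] by blast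
qed

text \<open>The class of \<open>x\<close> in the quotient by \<open>K\<close> is nonzero and the
  quotient is dualizable, so some functional on the quotient does not vanish there. Its pullback to
  \<open>M\<close> is the required \<open>f\<close>.\<close>

lemma separate:
  assumes M: "M \<in> \<M>" and K: "submodule K R M" and x: "x \<in> carrier M" "x \<notin> K"
  obtains f where "f \<in> carrier (matlis_dual R E M)" "\<And>y. y \<in> K \<Longrightarrow> f y = \<zero>\<^bsub>E\<^esub>" "f x \<noteq> \<zero>\<^bsub>E\<^esub>"
proof -
  obtain N p where N: "N \<in> \<M>" and p: "p \<in> module_hom R M N"
      "\<And>x. x \<in> carrier M \<Longrightarrow> p x = \<zero>\<^bsub>N\<^esub> \<longleftrightarrow> x \<in> K"
    using quotient_in[OF M K] by metis
  have "p x \<in> carrier N" "p x \<noteq> \<zero>\<^bsub>N\<^esub>"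
    using module_homD(1)[OF p(1) x(1)] p(2) x by auto
  then obtain g where g: "g \<in> carrier (matlis_dual R E N)" "g (p x) \<noteq> \<zero>\<^bsub>E\<^esub>"
    using matlis_dualizable_separates[OF dualizable[OF N] E] by blast
  show thesis
  proof
    show "dual_map M p g \<in> carrier (matlis_dual R E M)"
      using module_homD(1)[OF dual_map_hom[OF p(1) class_module[OF M] class_module[OF N] E] g(1)] .
    show "dual_map M p g y = \<zero>\<^bsub>E\<^esub>" if "y \<in> K" for y
    proof -
      have "y \<in> carrier M"
        using that submodule_subset[OF K] by auto
      then show ?thesis
        using p(2)[of y] that module_hom_zero[OF dual_hom[OF g(1)] class_module[OF N] E] by simp
    qed
    show "dual_map M p g x \<noteq> \<zero>\<^bsub>E\<^esub>"
      using g(2) x(1) by simp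
  qed
qed

lemma \<alpha>s_eq:
  assumes "M \<in> \<M>" "module R X" "\<phi> \<in> module_iso R X (matlis_dual R E M)"
  shows "\<alpha>s X = {x \<in> carrier X. \<forall>m\<in>\<alpha> M. \<phi> x m = \<zero>\<^bsub>E\<^esub>}"
  using smile_dual_eq[OF E selector assms(1) dualizable] assms by blast

lemma \<alpha>s_dual:
  assumes "M \<in> \<M>"
  shows "\<alpha>s (matlis_dual R E M) = {f \<in> carrier (matlis_dual R E M). \<forall>m\<in>\<alpha> M. f m = \<zero>\<^bsub>E\<^esub>}"
  using \<alpha>s_eq[OF assms dual_module[OF class_module[OF assms] E] module_iso_id] .

lemma in_dual_modulesI:
  "M \<in> \<M> \<Longrightarrow> module R X \<Longrightarrow> \<phi> \<in> module_iso R X (matlis_dual R E M) \<Longrightarrow> X \<in> dual_modules"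
  by (auto simp: dual_class_def)

text \<open>Evaluating \<open>\<phi> x\<close> at the elements of \<open>\<alpha>(M)\<close> identifies \<open>X/\<alpha>\<^sup>s(X)\<close> with the dual of \<open>\<alpha>(M)\<close>;
  it is onto because \<open>E\<close> is injective.\<close>

lemma \<alpha>s_restriction:
  assumes M: "M \<in> \<M>" and X: "module R X" and \<phi>: "\<phi> \<in> module_iso R X (matlis_dual R E M)"
  defines "N \<equiv> restrict_module M (\<alpha> M)"
  defines "\<rho> \<equiv> (\<lambda>x. dual_map N (\<lambda>x. x) (\<phi> x))"
  shows "\<rho> \<in> module_hom R X (matlis_dual R E N)"
    and "\<rho> ` carrier X = carrier (matlis_dual R E N)"
    and "\<alpha>s X = {x \<in> carrier X. \<rho> x = \<zero>\<^bsub>matlis_dual R E N\<^esub>}"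
proof -
  note sub = selectorD(1)[OF selector M]
  have mN: "module R N"
    using class_module[OF selectorD(2)[OF selector M]] by (simp add: N_def)
  show \<rho>: "\<rho> \<in> module_hom R X (matlis_dual R E N)"
    unfolding \<rho>_def
    using module_hom_comp[OF module_iso_hom[OF \<phi>] dual_map_hom[OF _ mN class_module[OF M] E]] submodule_hom[OF sub]
    by (simp add: N_def)
  show "\<rho> ` carrier X = carrier (matlis_dual R E N)"
    using dual_map_restriction_surj[OF inj class_module[OF M] sub] module_iso_image[OF \<phi>]
    unfolding \<rho>_def N_def by (metis image_image)
  have "\<rho> x = \<zero>\<^bsub>matlis_dual R E N\<^esub> \<longleftrightarrow> (\<forall>m\<in>\<alpha> M. \<phi> x m = \<zero>\<^bsub>E\<^esub>)" if x: "x \<in> carrier X" for x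
  proof -
    have app: "\<rho> x m = \<phi> x m" if "m \<in> \<alpha> M" for m
      using that by (simp add: \<rho>_def N_def)
    have z: "\<zero>\<^bsub>matlis_dual R E N\<^esub> \<in> carrier (matlis_dual R E N)"
      using submodule_zero[OF module.carrier_is_submodule[OF dual_module[OF mN E]]] .
    have z_app: "\<zero>\<^bsub>matlis_dual R E N\<^esub> m = \<zero>\<^bsub>E\<^esub>" if "m \<in> \<alpha> M" for m
      using that by (simp add: N_def)
    have "\<rho> x = \<zero>\<^bsub>matlis_dual R E N\<^esub>" if "\<forall>m\<in>\<alpha> M. \<phi> x m = \<zero>\<^bsub>E\<^esub>"
      using that app z_app by (intro dual_eqI[OF module_homD(1)[OF \<rho> x] z]) (simp add: N_def)
    then show ?thesis
      using app z_app by metis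
  qed
  then show "\<alpha>s X = {x \<in> carrier X. \<rho> x = \<zero>\<^bsub>matlis_dual R E N\<^esub>}"
    unfolding \<alpha>s_eq[OF M X \<phi>] by blast
qed

section \<open>The smile dual as a selector on the dual class\<close>

lemma \<alpha>s_submodule:
  assumes "X \<in> dual_modules"
  shows "submodule (\<alpha>s X) R X"
proof -
  obtain M \<phi> where M: "M \<in> \<M>" and X: "module R X" and \<phi>: "\<phi> \<in> module_iso R X (matlis_dual R E M)"
    using assms by (rule dual_modulesE)
  show ?thesis
    unfolding \<alpha>s_restriction(3)[OF M X \<phi>]
    by (intro submodule_kernel \<alpha>s_restriction(1)[OF M X \<phi>] X dual_module class_module E selectorD(2)[OF selector M])
qed

text \<open>The smile dual at \<open>X\<close> corresponds under \<phi> to the annihilator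
  \<open>A\<close> of \<open>\<alpha> M\<close>, which is the dual of the quotient of
  \<open>M\<close> by \<open>\<alpha> M\<close>. As that quotient has a copy in the class, the smile
  dual at \<open>X\<close> is a member of the dual class.\<close>

lemma \<alpha>s_selector: "submodule_selector R dual_modules \<alpha>s"
  unfolding submodule_selector_def
proof (intro conjI ballI)
  fix X assume XD: "X \<in> dual_modules"
  show sub: "submodule (\<alpha>s X) R X"
    by (rule \<alpha>s_submodule) fact
  obtain M \<phi> where M: "M \<in> \<M>" and X: "module R X" and \<phi>: "\<phi> \<in> module_iso R X (matlis_dual R E M)"
    using XD by (rule dual_modulesE)
  obtain N p where N: "N \<in> \<M>" and p: "p \<in> module_hom R M N" "p ` carrier M = carrier N"
      "\<And>x. x \<in> carrier M \<Longrightarrow> p x = \<zero>\<^bsub>N\<^esub> \<longleftrightarrow> x \<in> \<alpha> M"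
    using quotient_in[OF M selectorD(1)[OF selector M]] by metis
  define A where "A = {f \<in> carrier (matlis_dual R E M). \<forall>x\<in>carrier M. p x = \<zero>\<^bsub>N\<^esub> \<longrightarrow> f x = \<zero>\<^bsub>E\<^esub>}"
  have A: "A = {f \<in> carrier (matlis_dual R E M). \<forall>m\<in>\<alpha> M. f m = \<zero>\<^bsub>E\<^esub>}"
    using p(3) selectorD(3)[OF selector M] by (auto simp: A_def)
  have iso: "dual_map M p \<in> module_iso R (matlis_dual R E N) (restrict_module (matlis_dual R E M) A)"
    unfolding A_def using p class_module M N E by (intro dual_map_iso_annihilator)
  have "\<phi> \<in> module_iso R (restrict_module X (\<alpha>s X)) (restrict_module (matlis_dual R E M) A)"
  proof (rule module_isoI)
    note hom = module_homD[OF module_iso_hom[OF \<phi>]]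
    show "\<phi> \<in> module_hom R (restrict_module X (\<alpha>s X)) (restrict_module (matlis_dual R E M) A)"
      using hom by (intro module_homI) (auto simp: \<alpha>s_eq[OF M X \<phi>] A)
    show "inj_on \<phi> (carrier (restrict_module X (\<alpha>s X)))"
      using module_iso_inj[OF \<phi>] submodule_subset[OF sub] by (auto intro: inj_on_subset)
    show "carrier (restrict_module (matlis_dual R E M) A) \<subseteq> \<phi> ` carrier (restrict_module X (\<alpha>s X))"
      by (auto simp: \<alpha>s_eq[OF M X \<phi>] A simp flip: module_iso_image[OF \<phi>])
  qed
  from module_iso_comp[OF this module_iso_inv[OF iso dual_module[OF class_module[OF N] E]]]
  show "restrict_module X (\<alpha>s X) \<in> dual_modules"
    by (rule in_dual_modulesI[OF N submodule.submodule_is_module[OF sub X]])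
next
  fix X Y \<psi> assume "X \<in> dual_modules" and Y: "Y \<in> dual_modules" and \<psi>: "\<psi> \<in> module_iso R X Y"
  then have X: "module R X"
    by (simp add: dual_class_def)
  obtain M \<phi> where M: "M \<in> \<M>" and mY: "module R Y" and \<phi>: "\<phi> \<in> module_iso R Y (matlis_dual R E M)"
    using Y by (rule dual_modulesE)
  \<comment> \<open>Composing with \<psi> presents \<open>X\<close> as the dual of the same
    \<open>M\<close>, so both sides are annihilators of \<open>\<alpha> M\<close>.\<close>
  show "\<psi> ` \<alpha>s X = \<alpha>s Y"
    unfolding \<alpha>s_eq[OF M mY \<phi>] \<alpha>s_eq[OF M X module_iso_comp[OF \<psi> \<phi>]]
    by (auto simp flip: module_iso_image[OF \<psi>])
qed

section \<open>Involutivity\<close>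

text \<open>A member is isomorphic to its bidual. Conversely, a module isomorphic to the dual of
  some \<open>X\<close> in the dual class is isomorphic to a bidual of a member, hence to that
  member, and the class is closed under isomorphism.\<close>

lemma dual_class_dual_modules: "dual_class R E dual_modules = \<M>"
proof (intro equalityI subsetI)
  fix M assume M: "M \<in> \<M>"
  then show "M \<in> dual_class R E dual_modules"
    using matlis_dualizable_iso[OF dualizable[OF M]] class_module[OF M] dual_in[OF M]
    unfolding dual_class_def[of R E dual_modules] by blast
next
  fix Y :: "('r, 'm) module" assume "Y \<in> dual_class R E dual_modules"
  then obtain X \<chi> where Y: "module R Y" and XD: "X \<in> dual_modules"
      and \<chi>: "\<chi> \<in> module_iso R Y (matlis_dual R E X)"
    unfolding dual_class_def[of R E dual_modules] by blast
  obtain M \<phi> where M: "M \<in> \<M>" and X: "module R X" and \<phi>: "\<phi> \<in> module_iso R X (matlis_dual R E M)"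
    using XD by (rule dual_modulesE)
  have "dual_map X \<phi> \<in> module_iso R (matlis_dual R E (matlis_dual R E M)) (matlis_dual R E X)"
    using \<phi> X E class_module[OF M] by (intro dual_map_iso dual_module)
  from module_iso_comp[OF matlis_dualizable_iso[OF dualizable[OF M]] this]
  have "(\<lambda>m. dual_map X \<phi> (bidual_map R E M m)) \<in> module_iso R M (matlis_dual R E X)" .
  from module_iso_comp[OF this module_iso_inv[OF \<chi> Y]] show "Y \<in> \<M>"
    by (rule iso_in[OF M Y])
qed

text \<open>The annihilator formula is applied to the dual class, with the dual of \<open>M\<close>
  as the member and the natural map as the isomorphism. The result is the double annihilator of
  \<open>\<alpha> M\<close>; separation of points from submodules shows that it is no larger than
  \<open>\<alpha> M\<close>.\<close>

lemma smile_dual_smile_dual: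
  assumes M: "M \<in> \<M>"
  shows "smile_dual R E dual_modules \<alpha>s M = \<alpha> M"
proof -
  have "smile_dual R E dual_modules \<alpha>s M
      = {m \<in> carrier M. \<forall>f\<in>\<alpha>s (matlis_dual R E M). bidual_map R E M m f = \<zero>\<^bsub>E\<^esub>}"
    by (rule smile_dual_eq[OF E \<alpha>s_selector dual_in[OF M] matlis_dualizable_dual[OF dualizable[OF M] E]
          class_module[OF M] matlis_dualizable_iso[OF dualizable[OF M]]])
  also have "\<dots> = {m \<in> carrier M. \<forall>f\<in>\<alpha>s (matlis_dual R E M). f m = \<zero>\<^bsub>E\<^esub>}"
    by (auto simp: \<alpha>s_dual[OF M])
  also have "\<dots> = \<alpha> M"
  proof (intro equalityI subsetI CollectI conjI ballI)
    fix m assume m: "m \<in> {m \<in> carrier M. \<forall>f\<in>\<alpha>s (matlis_dual R E M). f m = \<zero>\<^bsub>E\<^esub>}"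
    show "m \<in> \<alpha> M"
    proof (rule ccontr)
      assume "m \<notin> \<alpha> M"
      with m obtain f where "f \<in> carrier (matlis_dual R E M)" "\<And>y. y \<in> \<alpha> M \<Longrightarrow> f y = \<zero>\<^bsub>E\<^esub>" "f m \<noteq> \<zero>\<^bsub>E\<^esub>"
        using separate[OF M selectorD(1)[OF selector M], of m] by auto
      with m show False
        by (simp add: \<alpha>s_dual[OF M])
    qed
  qed (use selectorD(3)[OF selector M] in \<open>auto simp: \<alpha>s_dual[OF M]\<close>)
  finally show ?thesis .
qed

section \<open>Surjection-functoriality and order preservation\<close>

lemma surjection_functorial_iff: "surjection_functorial R \<M> \<alpha> \<longleftrightarrow> order_preserving R dual_modules \<alpha>s"
proof
  assume func: "surjection_functorial R \<M> \<alpha>"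
  show "order_preserving R dual_modules \<alpha>s"
    unfolding order_preserving_def
  proof (intro ballI allI impI, elim conjE)
    fix X L assume XD: "X \<in> dual_modules" and L: "submodule L R X"
      and LD: "restrict_module X L \<in> dual_modules"
    let ?L = "restrict_module X L"
    obtain M \<phi> where M: "M \<in> \<M>" and X: "module R X" and \<phi>: "\<phi> \<in> module_iso R X (matlis_dual R E M)"
      using XD by (rule dual_modulesE)
    obtain N \<psi> where N: "N \<in> \<M>" and mL: "module R ?L" and \<psi>: "\<psi> \<in> module_iso R ?L (matlis_dual R E N)"
      using LD by (rule dual_modulesE)
    \<comment> \<open>The maps \<open>?\<theta>\<close> and \<open>?\<eta>\<close> identify
      \<open>M\<close> and \<open>N\<close> with the duals of \<open>X\<close> and
      \<open>?L\<close>, and \<open>?\<rho>\<close> restricts functionals from \<open>X\<close> to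
      \<open>L\<close>.\<close>
    let ?\<theta> = "\<lambda>m. dual_map X \<phi> (bidual_map R E M m)"
    let ?\<eta> = "\<lambda>n. dual_map ?L \<psi> (bidual_map R E N n)"
    let ?\<rho> = "dual_map ?L (\<lambda>x. x)"
    have \<theta>: "?\<theta> \<in> module_iso R M (matlis_dual R E X)"
      using X E class_module[OF M] \<phi>
      by (intro module_iso_comp[OF matlis_dualizable_iso[OF dualizable[OF M]]] dual_map_iso dual_module)
    have \<eta>: "?\<eta> \<in> module_iso R N (matlis_dual R E ?L)"
      using mL E class_module[OF N] \<psi>
      by (intro module_iso_comp[OF matlis_dualizable_iso[OF dualizable[OF N]]] dual_map_iso dual_module)
    have \<rho>: "?\<rho> \<in> module_hom R (matlis_dual R E X) (matlis_dual R E ?L)"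
      using submodule_hom[OF L] mL X E by (rule dual_map_hom)
    \<comment> \<open>Restriction of functionals, read as a map from \<open>M\<close> to
      \<open>N\<close>. It is onto because functionals on \<open>L\<close> extend to
      \<open>X\<close>, so the hypothesis on surjections applies.\<close>
    define \<pi> where "\<pi> = (\<lambda>m. inv_into (carrier N) ?\<eta> (?\<rho> (?\<theta> m)))"
    have "\<pi> \<in> module_hom R M N"
      unfolding \<pi>_def
      by (rule module_hom_comp[OF module_hom_comp[OF module_iso_hom[OF \<theta>] \<rho>]
            module_iso_hom[OF module_iso_inv[OF \<eta> class_module[OF N]]]])
    moreover have "\<pi> ` carrier M = inv_into (carrier N) ?\<eta> ` ?\<rho> ` ?\<theta> ` carrier M"
      by (simp add: \<pi>_def image_image)
    then have "\<pi> ` carrier M = carrier N"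
      using module_iso_image[OF \<theta>] dual_map_restriction_surj[OF inj X L]
        module_iso_image[OF module_iso_inv[OF \<eta> class_module[OF N]]] by simp
    ultimately have \<pi>: "\<pi> ` \<alpha> M \<subseteq> \<alpha> N"
      using func M N by (simp add: surjection_functorial_def)
    \<comment> \<open>The inclusion of \<open>L\<close> and \<pi> are adjoint for the two pairings,
      which lets annihilation of \<open>\<alpha> N\<close> by \<open>x\<close> pass to annihilation
      of \<open>\<alpha> M\<close>.\<close>
    have app: "\<phi> x m = \<psi> x (\<pi> m)" if m: "m \<in> carrier M" and x: "x \<in> L" for m x
    proof -
      have xX: "x \<in> carrier X"
        using x submodule_subset[OF L] by auto
      have "?\<eta> (\<pi> m) = ?\<rho> (?\<theta> m)"
        unfolding \<pi>_def using module_homD(1)[OF \<rho> module_homD(1)[OF module_iso_hom[OF \<theta>] m]]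
          module_iso_image[OF \<eta>] by (intro f_inv_into_f) simp
      moreover have "?\<eta> (\<pi> m) x = \<psi> x (\<pi> m)"
        using x module_homD(1)[OF module_iso_hom[OF \<psi>], of x] by simp
      moreover have "?\<rho> (?\<theta> m) x = \<phi> x m"
        using x xX module_homD(1)[OF module_iso_hom[OF \<phi>], of x] by simp
      ultimately show ?thesis
        by simp
    qed
    show "\<alpha>s ?L \<subseteq> \<alpha>s X"
    proof
      fix x assume "x \<in> \<alpha>s ?L"
      then have x: "x \<in> L" "\<And>n. n \<in> \<alpha> N \<Longrightarrow> \<psi> x n = \<zero>\<^bsub>E\<^esub>"
        by (simp_all add: \<alpha>s_eq[OF N mL \<psi>])
      have "\<phi> x m = \<zero>\<^bsub>E\<^esub>" if m: "m \<in> \<alpha> M" for m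
      proof -
        have "m \<in> carrier M" "\<pi> m \<in> \<alpha> N"
          using m \<pi> selectorD(3)[OF selector M] by auto
        then show ?thesis
          using app x by simp
      qed
      moreover have "x \<in> carrier X"
        using x(1) submodule_subset[OF L] by auto
      ultimately show "x \<in> \<alpha>s X"
        by (simp add: \<alpha>s_eq[OF M X \<phi>])
    qed
  qed
next
  assume ord: "order_preserving R dual_modules \<alpha>s"
  show "surjection_functorial R \<M> \<alpha>"
    unfolding surjection_functorial_def
  proof (intro ballI impI subsetI)
    fix M N \<pi> y assume M: "M \<in> \<M>" and N: "N \<in> \<M>" and \<pi>: "\<pi> \<in> module_hom R M N"
      and surj: "\<pi> ` carrier M = carrier N" and y: "y \<in> \<pi> ` \<alpha> M"
    obtain m where m: "m \<in> \<alpha> M" "y = \<pi> m"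
      using y by auto
    then have mM: "m \<in> carrier M"
      using selectorD(3)[OF selector M] by auto
    let ?DM = "matlis_dual R E M" and ?DN = "matlis_dual R E N"
    \<comment> \<open>The image of the dual of \<open>N\<close> under the dual of \<pi>, written as
      the annihilator of the kernel of \<pi>.\<close>
    define L where "L = {f \<in> carrier ?DM. \<forall>x\<in>carrier M. \<pi> x = \<zero>\<^bsub>N\<^esub> \<longrightarrow> f x = \<zero>\<^bsub>E\<^esub>}"
    have iso: "dual_map M \<pi> \<in> module_iso R ?DN (restrict_module ?DM L)"
      unfolding L_def using \<pi> surj class_module[OF M] class_module[OF N] E by (rule dual_map_iso_annihilator)
    note mDM = dual_module[OF class_module[OF M] E] and mDN = dual_module[OF class_module[OF N] E]
    have "L = dual_map M \<pi> ` carrier ?DN"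
      using module_iso_image[OF iso] by simp
    then have L: "submodule L R ?DM"
      using submodule_image[OF dual_map_hom[OF \<pi> class_module[OF M] class_module[OF N] E] mDN mDM
          module.carrier_is_submodule[OF mDN]] by simp
    note mL = submodule.submodule_is_module[OF L mDM]
    have LD: "restrict_module ?DM L \<in> dual_modules"
      by (rule in_dual_modulesI[OF N mL module_iso_inv[OF iso mDN]])
    \<comment> \<open>Invariance of the selector under isomorphism turns order preservation for the
      inclusion of \<open>L\<close> into a statement about the dual of \<pi>.\<close>
    have "dual_map M \<pi> ` \<alpha>s ?DN = \<alpha>s (restrict_module ?DM L)"
      using \<alpha>s_selector iso dual_in[OF N] LD by (simp add: submodule_selector_def)
    also have "\<dots> \<subseteq> \<alpha>s ?DM"
      using ord dual_in[OF M] L LD by (simp add: order_preserving_def)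
    finally have le: "dual_map M \<pi> ` \<alpha>s ?DN \<subseteq> \<alpha>s ?DM" .
    show "y \<in> \<alpha> N"
    proof (rule ccontr)
      assume "y \<notin> \<alpha> N"
      moreover have "y \<in> carrier N"
        using m mM surj by auto
      \<comment> \<open>The pullback of \<open>g\<close> along \<pi> must annihilate
        \<open>\<alpha> M\<close>, yet its value at \<open>m\<close> is the nonzero
        \<open>g y\<close>.\<close>
      ultimately obtain g where g: "g \<in> carrier ?DN" "\<And>n. n \<in> \<alpha> N \<Longrightarrow> g n = \<zero>\<^bsub>E\<^esub>" "g y \<noteq> \<zero>\<^bsub>E\<^esub>"
        using separate[OF N selectorD(1)[OF selector N]] by blast
      then have "dual_map M \<pi> g \<in> \<alpha>s ?DM"
        using le by (auto simp: \<alpha>s_dual[OF N])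
      then have "dual_map M \<pi> g m = \<zero>\<^bsub>E\<^esub>"
        using m(1) by (simp add: \<alpha>s_dual[OF M])
      then show False
        using g(3) m(2) mM by simp
    qed
  qed
qed

section \<open>Idempotence and co-idempotence\<close>

text \<open>The quotient is the dual of the module \<open>?N\<close> carried by
  \<open>\<alpha> M\<close>. Its selected submodule therefore corresponds to the annihilator of
  \<open>\<alpha> ?N\<close> among the functionals on \<open>?N\<close>, which is zero exactly when
  \<open>\<alpha> ?N\<close> is all of \<open>?N\<close>.\<close>

lemma \<alpha>s_quotient_eq_zero_iff:
  assumes M: "M \<in> \<M>" and X: "module R X" and \<phi>: "\<phi> \<in> module_iso R X (matlis_dual R E M)"
  shows "selector_at R dual_modules \<alpha>s (quotient_module X (\<alpha>s X)) = {\<zero>\<^bsub>quotient_module X (\<alpha>s X)\<^esub>}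
    \<longleftrightarrow> \<alpha> (restrict_module M (\<alpha> M)) = \<alpha> M"
proof -
  let ?N = "restrict_module M (\<alpha> M)"
  let ?D = "matlis_dual R E ?N" and ?Q = "quotient_module X (\<alpha>s X)"
  let ?\<rho> = "\<lambda>x. dual_map ?N (\<lambda>x. x) (\<phi> x)"
  note \<rho> = \<alpha>s_restriction[OF M X \<phi>]
  have N: "?N \<in> \<M>"
    by (rule selectorD(2)[OF selector M])
  note mD = dual_module[OF class_module[OF N] E]
  have A: "submodule (\<alpha>s X) R X"
    by (rule \<alpha>s_submodule[OF in_dual_modulesI[OF M X \<phi>]])
  note mQ = quotient_module_is_module[OF X A] and zQ = quotient_module_zero[OF X A]
  note q = quotient_module_proj[OF X A] and surj = quotient_module_surj[OF X A]
  have ker: "\<alpha>s X +>\<^bsub>X\<^esub> x = \<zero>\<^bsub>?Q\<^esub> \<longleftrightarrow> ?\<rho> x = \<zero>\<^bsub>?D\<^esub>" if "x \<in> carrier X" for x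
    using quotient_module_coset_eq[OF X A that] zQ that unfolding \<rho>(3) by simp
  \<comment> \<open>The restriction map \<open>?\<rho>\<close> has the smile dual at
    \<open>X\<close> as its kernel, so it induces a map on the quotient. This map is injective, and
    surjective since \<open>?\<rho>\<close> is.\<close>
  obtain \<psi> where \<psi>: "\<psi> \<in> module_hom R ?Q ?D" "\<And>x. x \<in> carrier X \<Longrightarrow> \<psi> (\<alpha>s X +>\<^bsub>X\<^esub> x) = ?\<rho> x"
    using module_hom_factor[OF q \<rho>(1) X mQ mD surj] ker by metis
  have \<psi>_iso: "\<psi> \<in> module_iso R ?Q ?D"
  proof (rule module_isoI[OF \<psi>(1) module_hom_inj_onI[OF \<psi>(1) mQ mD]])
    show "c = \<zero>\<^bsub>?Q\<^esub>" if c: "c \<in> carrier ?Q" "\<psi> c = \<zero>\<^bsub>?D\<^esub>" for c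
    proof -
      obtain x where "x \<in> carrier X" "c = \<alpha>s X +>\<^bsub>X\<^esub> x"
        using c(1) surj by blast
      then show ?thesis
        using c(2) \<psi>(2) ker by simp
    qed
    have "\<psi> ` carrier ?Q = ?\<rho> ` carrier X"
      unfolding surj[symmetric] using \<psi>(2) by force
    then show "carrier ?D \<subseteq> \<psi> ` carrier ?Q"
      using \<rho>(2) by simp
  qed
  have "selector_at R dual_modules \<alpha>s ?Q = {c \<in> carrier ?Q. \<psi> c \<in> \<alpha>s ?D}"
    by (rule selector_at_eq[OF \<alpha>s_selector mQ dual_in[OF N] \<psi>_iso])
  moreover have "\<alpha>s ?D \<subseteq> \<psi> ` carrier ?Q"
    using module_iso_image[OF \<psi>_iso] submodule_subset[OF \<alpha>s_submodule[OF dual_in[OF N]]] by simp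
  ultimately have im: "\<psi> ` selector_at R dual_modules \<alpha>s ?Q = \<alpha>s ?D"
    and sub: "selector_at R dual_modules \<alpha>s ?Q \<subseteq> carrier ?Q"
    by auto
  have "\<zero>\<^bsub>?Q\<^esub> \<in> carrier ?Q" "\<psi> \<zero>\<^bsub>?Q\<^esub> = \<zero>\<^bsub>?D\<^esub>"
    using submodule_zero[OF module.carrier_is_submodule[OF mQ]] module_hom_zero[OF \<psi>(1) mQ mD] by auto
  then have "selector_at R dual_modules \<alpha>s ?Q = {\<zero>\<^bsub>?Q\<^esub>} \<longleftrightarrow> \<alpha>s ?D = {\<zero>\<^bsub>?D\<^esub>}"
    using inj_on_image_eq_iff[OF module_iso_inj[OF \<psi>_iso] sub, of "{\<zero>\<^bsub>?Q\<^esub>}"] im by auto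
  also have "\<dots> \<longleftrightarrow> \<alpha> ?N = \<alpha> M"
  proof
    assume zero: "\<alpha>s ?D = {\<zero>\<^bsub>?D\<^esub>}"
    show "\<alpha> ?N = \<alpha> M"
    \<comment> \<open>A point of \<open>?N\<close> outside \<open>\<alpha> ?N\<close> would be
      detected by a functional that kills \<open>\<alpha> ?N\<close>, and this functional would be a
      nonzero element of the annihilator.\<close>
    proof (rule ccontr)
      assume "\<alpha> ?N \<noteq> \<alpha> M"
      then obtain x where x: "x \<in> carrier ?N" "x \<notin> \<alpha> ?N"
        using selectorD(3)[OF selector N] by auto
      then obtain f where f: "f \<in> carrier ?D" "\<And>y. y \<in> \<alpha> ?N \<Longrightarrow> f y = \<zero>\<^bsub>E\<^esub>" "f x \<noteq> \<zero>\<^bsub>E\<^esub>"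
        using separate[OF N selectorD(1)[OF selector N]] by blast
      then have "f = \<zero>\<^bsub>?D\<^esub>"
        using zero unfolding \<alpha>s_dual[OF N] by blast
      then show False
        using f(3) x(1) by simp
    qed
  next
    assume eq: "\<alpha> ?N = \<alpha> M"
    have z: "\<zero>\<^bsub>?D\<^esub> \<in> carrier ?D"
      using submodule_zero[OF module.carrier_is_submodule[OF mD]] .
    have "f = \<zero>\<^bsub>?D\<^esub>" if "f \<in> carrier ?D" "\<forall>m\<in>\<alpha> M. f m = \<zero>\<^bsub>E\<^esub>" for f
      using that by (intro dual_eqI[OF that(1) z]) simp
    moreover have "\<forall>m\<in>\<alpha> M. \<zero>\<^bsub>?D\<^esub> m = \<zero>\<^bsub>E\<^esub>"
      by simp
    ultimately show "\<alpha>s ?D = {\<zero>\<^bsub>?D\<^esub>}"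
      using z unfolding \<alpha>s_dual[OF N] eq by blast
  qed
  finally show ?thesis .
qed

text \<open>For one direction each \<open>X\<close> in the dual class is presented as the dual of a
  member; for the other, the dual of \<open>M\<close> itself serves as \<open>X\<close>, with the
  identity as isomorphism.\<close>

lemma idempotent_iff: "idempotent_selector \<M> \<alpha> \<longleftrightarrow> co_idempotent_selector R dual_modules \<alpha>s"
proof
  assume idem: "idempotent_selector \<M> \<alpha>"
  show "co_idempotent_selector R dual_modules \<alpha>s"
    unfolding co_idempotent_selector_def
  proof
    fix X assume "X \<in> dual_modules"
    then obtain M \<phi> where "M \<in> \<M>" "module R X" "\<phi> \<in> module_iso R X (matlis_dual R E M)"
      by (rule dual_modulesE)
    with idem show "selector_at R dual_modules \<alpha>s (quotient_module X (\<alpha>s X)) = {\<zero>\<^bsub>quotient_module X (\<alpha>s X)\<^esub>}"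
      by (simp add: \<alpha>s_quotient_eq_zero_iff idempotent_selector_def)
  qed
next
  assume coidem: "co_idempotent_selector R dual_modules \<alpha>s"
  show "idempotent_selector \<M> \<alpha>"
    unfolding idempotent_selector_def
  proof
    fix M assume M: "M \<in> \<M>"
    then show "\<alpha> (restrict_module M (\<alpha> M)) = \<alpha> M"
      using coidem dual_in[OF M] \<alpha>s_quotient_eq_zero_iff[OF M dual_module[OF class_module[OF M] E] module_iso_id]
      by (simp add: co_idempotent_selector_def)
  qed
qed

end

theorem theorem3p2:
  fixes R :: "('r, 's) ring_scheme"
    and \<mm> :: "'r set"
    and E :: "('r, 'e) module"
    and \<M> :: "('r, 'm) module set"
    and \<alpha> :: "('r, 'm) selector"
  assumes "complete_noetherian_local_ring R \<mm>"
    and "injective_hull R (quotient_module (regular_module R) \<mm>) E"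
    and "module_class R \<M>"
    and "\<forall>M\<in>\<M>. matlis_dualizable R E M"
    and "closed_under_submodules R \<M>"
    and "closed_under_quotients R \<M>"
    and "submodule_selector R \<M> \<alpha>"
  shows "let \<M>d = (dual_class R E \<M> :: ('r, 'm \<Rightarrow> 'e) module set);
             \<alpha>s = (smile_dual R E \<M> \<alpha> :: ('r, 'm \<Rightarrow> 'e) selector)
         in submodule_selector R \<M>d \<alpha>s \<and>
            (dual_class R E \<M>d = \<M> \<and> (\<forall>M\<in>\<M>. smile_dual R E \<M>d \<alpha>s M = \<alpha> M)) \<and>
            (surjection_functorial R \<M> \<alpha> \<longleftrightarrow> order_preserving R \<M>d \<alpha>s) \<and>
            (idempotent_selector \<M> \<alpha> \<longleftrightarrow> co_idempotent_selector R \<M>d \<alpha>s)"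
proof -
  interpret dualizable_selector R E \<M> \<alpha>
    using assms by unfold_locales (auto simp: injective_hull_def)
  show ?thesis
    unfolding Let_def
    by (intro conjI ballI \<alpha>s_selector dual_class_dual_modules smile_dual_smile_dual
        surjection_functorial_iff idempotent_iff)
qed

end
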